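(* Let $0\le T_0<T_1\le+\infty$, let $\Gamma$ be a network with Hamiltonians $\{H_\gamma\}$ and flux limiter $x\mapsto c_x$ as described in the context, and let $g:\Gamma\to\mathbb{R}$ be continuous. Then there exists at most one uniformly continuous solution $u:\Gamma\times[T_0,T_1)\to\mathbb{R}$ of (HJ$\Gamma$) in $(T_0,T_1)$ with $u(\cdot,T_0)=g$ on $\Gamma$.
   Context: Network. $\Gamma=\bigcup_{\gamma\in\mathcal{E}}\gamma([0,1])\subset\mathbb{R}^N$, where $\mathcal{E}$ is a finite collection of arcs, i.e. simple $C^1$ curves $\gamma:[0,1]\to\mathbb{R}^N$ with nonvanishing derivative. Together with each arc $\gamma$ one also considers its inverse arc $-\gamma(s)=\gamma(1-s)$ (so the collection of arcs is regarded as closed under inversion). It is assumed that $\gamma((0,1))\cap\gamma'([0,1])=\emptyset$ whenever $\gamma'\ne\gamma$, $\gamma'\neq-\gamma$. Vertices are the initial and terminal points of arcs; $\mathbf{V}$ is the set of vertices. The network is connected (any two vertices are linked by a finite concatenation of arcs) and has no loops ($\gamma(0)\ne\gamma(1)$ for every arc). For $x\in\mathbf{V}$, $\Gamma_x=\{\gamma : \gamma(1)=x\}$. Hamiltonians. For each arc $\gamma$ a function $H_\gamma:[0,1]\times\mathbb{R}\to\mathbb{R}$ is given, with $H_{-\gamma}(s,p)=H_\gamma(1-s,-p)$. Each $H_\gamma$ is continuous in $(s,p)$, convex in $p$, coercive in $p$ uniformly in $s$, and for every $M>0$ there is $C_M$ with $H_\gamma(s,p)-H_\gamma(s,q)\le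 C_M|p-q|$ for all $s\in[0,1]$, $p,q\in(-M,M)$. Set $c_\gamma=-\max_{s\in[0,1]}\min_{p\in\mathbb{R}}H_\gamma(s,p)$. A flux limiter is a function $x\mapsto c_x$ from $\mathbf{V}$ to $\mathbb{R}$ with $c_x\le\min_{\gamma\in\Gamma_x}c_\gamma$ for all $x$. Equation. For $v:\Gamma\times[T_0,T_1)\to\mathbb{R}$ put $(v\circ\gamma)(s,t)=v(\gamma(s),t)$; $'$ denotes the derivative in $s$ and subscript $t$ that in $t$. (HJ$_\gamma$) is $w_t+H_\gamma(s,w')=0$ in $(0,1)\times(T_0,T_1)$. A subtangent (resp. supertangent) to a function at a point is a $C^1$ function $\varphi$ such that (function $-\varphi$) has a local minimum (resp. maximum) at that point; it is constrained to a closed set $C$ if the point is a minimizer (resp. maximizer) only relative to a neighborhood of it intersected with $C$. A continuous $v:\Gamma\times[T_0,T_1)\to\mathbb{R}$ is a supersolution of (HJ$\Gamma$) in $(T_0,T_1)$ if (i) $v\circ\gamma$ is a viscosity supersolution of (HJ$_\gamma$) for every arc $\gamma$; (ii) for every $x\in\mathbf{V}$, $t_0\in(T_0,T_1)$: if some $C^1$ subtangent $\phi$ to $v(x,\cdot)$ at $t_0$ satisfies $\frac{d}{dt}\phi(t_0)<c_x$, then there is an arc $\gamma\in\Gamma_x$ such that all $C^1$ subtangents $\varphi$, constrained to $[0,1]\times\overline{(T_0,T_1)}$, to $v\circ\gamma$ at $(1,t_0)$ satisfy $\varphi_t(1,t_0)+H_\gamma(1,\varphi'(1,t_0))\ge0$.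 It is a subsolution of (HJ$\Gamma$) in $(T_0,T_1)$ if (i) $v\circ\gamma$ is a viscosity subsolution of (HJ$_\gamma$) for every arc $\gamma$; (ii) for every $x\in\mathbf{V}$, $t_0\in(T_0,T_1)$, all $C^1$ supertangents $\psi$ to $v(x,\cdot)$ at $t_0$ satisfy $\frac{d}{dt}\psi(t_0)\le c_x$. A solution is a continuous function that is both a subsolution and a supersolution. *)

theory Defs
  imports "HOL-Analysis.Analysis"
begin

section \<open>Networks\<close>

text \<open>
  An arc is a map on [0,1], represented by a function on all of the reals whose values outside
  [0,1] play no role. Any arc can be extended compatibly with inversion (by composing with the
  projection onto [0,1]), and the disjointness clause of \<open>network\<close> forbids two different functions
  in \<open>E\<close> with the same restriction to [0,1]. So \<open>E\<close> is a set of arcs in the usual sense, and the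
  inverse of an arc is its \<^const>\<open>reversepath\<close>.
\<close>

definition regular_C1 :: "(real \<Rightarrow> 'a::euclidean_space) \<Rightarrow> bool" where
  "regular_C1 \<gamma> \<longleftrightarrow>
     (\<exists>D. continuous_on {0..1} D \<and>
          (\<forall>s\<in>{0..1}. (\<gamma> has_vector_derivative D s) (at s within {0..1}) \<and> D s \<noteq> 0))"

definition net :: "(real \<Rightarrow> 'a::euclidean_space) set \<Rightarrow> 'a set" where
  "net E = (\<Union>\<gamma>\<in>E. path_image \<gamma>)"

definition vertices :: "(real \<Rightarrow> 'a::euclidean_space) set \<Rightarrow> 'a set" where
  "vertices E = pathstart ` E \<union> pathfinish ` E"

definition arcs_into :: "(real \<Rightarrow> 'a::euclidean_space) set \<Rightarrow> 'a \<Rightarrow> (real \<Rightarrow> 'a) set" where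
  "arcs_into E x = {\<gamma> \<in> E. pathfinish \<gamma> = x}"

definition network :: "(real \<Rightarrow> 'a::euclidean_space) set \<Rightarrow> bool" where
  "network E \<longleftrightarrow>
     finite E \<and>
     (\<forall>\<gamma>\<in>E. simple_path \<gamma> \<and> regular_C1 \<gamma>) \<and>
     (\<forall>\<gamma>\<in>E. reversepath \<gamma> \<in> E) \<and>
     (\<forall>\<gamma>\<in>E. \<forall>\<gamma>'\<in>E. \<gamma>' \<noteq> \<gamma> \<and> \<gamma>' \<noteq> reversepath \<gamma> \<longrightarrow>
        \<gamma> ` {0<..<1} \<inter> \<gamma>' ` {0..1} = {}) \<and>
     (\<forall>x\<in>vertices E. \<forall>y\<in>vertices E.
        (x, y) \<in> {(pathstart \<gamma>, pathfinish \<gamma>) | \<gamma>. \<gamma> \<in> E}\<^sup>*) \<and>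
     (\<forall>\<gamma>\<in>E. pathstart \<gamma> \<noteq> pathfinish \<gamma>)"


section \<open>Hamiltonians and flux limiters\<close>

definition hamiltonians ::
    "(real \<Rightarrow> 'a::euclidean_space) set \<Rightarrow> ((real \<Rightarrow> 'a) \<Rightarrow> real \<Rightarrow> real \<Rightarrow> real) \<Rightarrow> bool" where
  "hamiltonians E H \<longleftrightarrow>
     (\<forall>\<gamma>\<in>E.
        (\<forall>s\<in>{0..1}. \<forall>p. H (reversepath \<gamma>) s p = H \<gamma> (1 - s) (- p)) \<and>
        continuous_on ({0..1} \<times> UNIV) (\<lambda>(s, p). H \<gamma> s p) \<and>
        (\<forall>s\<in>{0..1}. convex_on UNIV (H \<gamma> s)) \<and>
        (\<forall>K. \<exists>R. \<forall>s\<in>{0..1}. \<forall>p. \<bar>p\<bar> \<ge> R \<longrightarrow> H \<gamma> s p \<ge> K) \<and>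
        (\<forall>M>0. \<exists>C. \<forall>s\<in>{0..1}. \<forall>p\<in>{-M<..<M}. \<forall>q\<in>{-M<..<M}.
           H \<gamma> s p - H \<gamma> s q \<le> C * \<bar>p - q\<bar>))"

text \<open>
  By continuity and coercivity, the supremum and the infima below are attained, so they are the
  maximum over \<open>s\<close> and the minima over \<open>p\<close>.
\<close>

definition arc_const :: "(real \<Rightarrow> real \<Rightarrow> real) \<Rightarrow> real" where
  "arc_const h = - (SUP s\<in>{0..1}. INF p. h s p)"

definition flux_limiter ::
    "(real \<Rightarrow> 'a::euclidean_space) set \<Rightarrow> ((real \<Rightarrow> 'a) \<Rightarrow> real \<Rightarrow> real \<Rightarrow> real) \<Rightarrow> ('a \<Rightarrow> real) \<Rightarrow> bool"
  where
  "flux_limiter E H c \<longleftrightarrow>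
     (\<forall>x\<in>vertices E. c x \<le> Min ((\<lambda>\<gamma>. arc_const (H \<gamma>)) ` arcs_into E x))"


section \<open>Tangent test functions\<close>

definition C1_near :: "('z::real_normed_vector \<Rightarrow> real) \<Rightarrow> 'z \<Rightarrow> bool" where
  "C1_near \<phi> z \<longleftrightarrow>
     (\<exists>U D. open U \<and> z \<in> U \<and> continuous_on U D \<and>
            (\<forall>w\<in>U. (\<phi> has_derivative blinfun_apply (D w)) (at w)))"

text \<open>
  Tangents constrained to a set \<open>C\<close>. Unconstrained ones are the case \<open>C = UNIV\<close>; they are only used
  at interior points of the domain of \<open>f\<close>, so values of \<open>f\<close> outside its domain do not matter.
\<close>

definition subtangent ::
    "'z set \<Rightarrow> ('z::real_normed_vector \<Rightarrow> real) \<Rightarrow> 'z \<Rightarrow> ('z \<Rightarrow> real) \<Rightarrow> bool" where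
  "subtangent C f z \<phi> \<longleftrightarrow>
     C1_near \<phi> z \<and> (\<exists>\<epsilon>>0. \<forall>w \<in> ball z \<epsilon> \<inter> C. f z - \<phi> z \<le> f w - \<phi> w)"

definition supertangent ::
    "'z set \<Rightarrow> ('z::real_normed_vector \<Rightarrow> real) \<Rightarrow> 'z \<Rightarrow> ('z \<Rightarrow> real) \<Rightarrow> bool" where
  "supertangent C f z \<phi> \<longleftrightarrow>
     C1_near \<phi> z \<and> (\<exists>\<epsilon>>0. \<forall>w \<in> ball z \<epsilon> \<inter> C. f w - \<phi> w \<le> f z - \<phi> z)"


section \<open>Solutions\<close>

definition open_time :: "real \<Rightarrow> ereal \<Rightarrow> real set" where
  "open_time T0 T1 = {t. T0 < t \<and> ereal t < T1}"

definition time_dom :: "real \<Rightarrow> ereal \<Rightarrow> real set" where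
  "time_dom T0 T1 = {t. T0 \<le> t \<and> ereal t < T1}"

text \<open>The expression \<open>\<phi>\<^sub>t + h(s, \<phi>')\<close> at the point \<open>(s, t)\<close>.\<close>

definition HJ_expr :: "(real \<Rightarrow> real \<Rightarrow> real) \<Rightarrow> (real \<times> real \<Rightarrow> real) \<Rightarrow> real \<Rightarrow> real \<Rightarrow> real" where
  "HJ_expr h \<phi> s t = deriv (\<lambda>\<tau>. \<phi> (s, \<tau>)) t + h s (deriv (\<lambda>\<sigma>. \<phi> (\<sigma>, t)) s)"

definition visc_supersol ::
    "(real \<Rightarrow> real \<Rightarrow> real) \<Rightarrow> real \<Rightarrow> ereal \<Rightarrow> (real \<times> real \<Rightarrow> real) \<Rightarrow> bool" where
  "visc_supersol h T0 T1 w \<longleftrightarrow>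
     (\<forall>s\<in>{0<..<1}. \<forall>t\<in>open_time T0 T1. \<forall>\<phi>.
        subtangent UNIV w (s, t) \<phi> \<longrightarrow> HJ_expr h \<phi> s t \<ge> 0)"

definition visc_subsol ::
    "(real \<Rightarrow> real \<Rightarrow> real) \<Rightarrow> real \<Rightarrow> ereal \<Rightarrow> (real \<times> real \<Rightarrow> real) \<Rightarrow> bool" where
  "visc_subsol h T0 T1 w \<longleftrightarrow>
     (\<forall>s\<in>{0<..<1}. \<forall>t\<in>open_time T0 T1. \<forall>\<phi>.
        supertangent UNIV w (s, t) \<phi> \<longrightarrow> HJ_expr h \<phi> s t \<le> 0)"

definition along :: "('a \<times> real \<Rightarrow> real) \<Rightarrow> (real \<Rightarrow> 'a) \<Rightarrow> real \<times> real \<Rightarrow> real" where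
  "along v \<gamma> = (\<lambda>(s, t). v (\<gamma> s, t))"

definition HJ_supersolution ::
    "(real \<Rightarrow> 'a::euclidean_space) set \<Rightarrow> ((real \<Rightarrow> 'a) \<Rightarrow> real \<Rightarrow> real \<Rightarrow> real) \<Rightarrow> ('a \<Rightarrow> real) \<Rightarrow>
     real \<Rightarrow> ereal \<Rightarrow> ('a \<times> real \<Rightarrow> real) \<Rightarrow> bool" where
  "HJ_supersolution E H c T0 T1 v \<longleftrightarrow>
     continuous_on (net E \<times> time_dom T0 T1) v \<and>
     (\<forall>\<gamma>\<in>E. visc_supersol (H \<gamma>) T0 T1 (along v \<gamma>)) \<and>
     (\<forall>x\<in>vertices E. \<forall>t\<in>open_time T0 T1.
        (\<exists>\<phi>. subtangent UNIV (\<lambda>\<tau>. v (x, \<tau>)) t \<phi> \<and> deriv \<phi> t < c x) \<longrightarrow>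
        (\<exists>\<gamma>\<in>arcs_into E x. \<forall>\<phi>.
           subtangent ({0..1} \<times> closure (open_time T0 T1)) (along v \<gamma>) (1, t) \<phi> \<longrightarrow>
           HJ_expr (H \<gamma>) \<phi> 1 t \<ge> 0))"

definition HJ_subsolution ::
    "(real \<Rightarrow> 'a::euclidean_space) set \<Rightarrow> ((real \<Rightarrow> 'a) \<Rightarrow> real \<Rightarrow> real \<Rightarrow> real) \<Rightarrow> ('a \<Rightarrow> real) \<Rightarrow>
     real \<Rightarrow> ereal \<Rightarrow> ('a \<times> real \<Rightarrow> real) \<Rightarrow> bool" where
  "HJ_subsolution E H c T0 T1 v \<longleftrightarrow>
     continuous_on (net E \<times> time_dom T0 T1) v \<and>
     (\<forall>\<gamma>\<in>E. visc_subsol (H \<gamma>) T0 T1 (along v \<gamma>)) \<and>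
     (\<forall>x\<in>vertices E. \<forall>t\<in>open_time T0 T1. \<forall>\<psi>.
        supertangent UNIV (\<lambda>\<tau>. v (x, \<tau>)) t \<psi> \<longrightarrow> deriv \<psi> t \<le> c x)"

definition HJ_solution ::
    "(real \<Rightarrow> 'a::euclidean_space) set \<Rightarrow> ((real \<Rightarrow> 'a) \<Rightarrow> real \<Rightarrow> real \<Rightarrow> real) \<Rightarrow> ('a \<Rightarrow> real) \<Rightarrow>
     real \<Rightarrow> ereal \<Rightarrow> ('a \<times> real \<Rightarrow> real) \<Rightarrow> bool" where
  "HJ_solution E H c T0 T1 v \<longleftrightarrow>
     HJ_subsolution E H c T0 T1 v \<and> HJ_supersolution E H c T0 T1 v"

end

theory Submission
  imports Defs
begin

text \<open>
  Comparison of a subsolution \<open>u\<close> with a supersolution \<open>v\<close>. Replace \<open>u\<close> by its sup-convolution in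
  time, \<open>w(x, t) = max\<^sub>r u(x, r) - k (t - r)\<^sup>2\<close>. It is again a subsolution, and a test function
  touching it from above at \<open>(x, t)\<close> has time derivative \<open>-2k(t - r)\<close> for every maximizer \<open>r\<close>.
  Suppose \<open>w - v - \<theta>(t)\<close>, with \<open>\<theta>\<close> increasing, has a maximum at \<open>(x0, t0)\<close>.

  If \<open>x0\<close> lies inside an arc, doubling the variables gives a contradiction: the bound on the time
  derivatives and coercivity keep the momenta in a compact set, where the Hamiltonian is uniformly
  continuous.

  If \<open>x0\<close> is a vertex, let \<open>r0\<close> be the least maximizer at \<open>(x0, t0)\<close> and \<open>a = -2k(t0 - r0)\<close>. The
  flux limiter bounds \<open>a\<close>, as is seen by testing \<open>u(x0, \<cdot>)\<close> at \<open>r0\<close>, so \<open>v(x0, \<cdot>)\<close> has a subtangent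
  of slope \<open>a - \<theta>'(t0) < c x0\<close> and satisfies the state constraint condition on some arc ending at
  \<open>x0\<close>. As \<open>r0\<close> is least, time derivatives of test functions near \<open>(x0, t0)\<close> are almost at least
  \<open>a\<close>. So their momenta lie almost in the sublevel set of level \<open>-a\<close>, hence below some \<open>P\<close> with
  \<open>H(1, P) < -a + \<theta>'(t0)\<close>, and \<open>w\<close> lies above the line of slope \<open>P\<close> through its value at the
  vertex. The resulting subtangent to \<open>v\<close> contradicts the state constraint condition.
\<close>

section \<open>Separated test functions: a function of position plus a function of time\<close>

text \<open>The derivative is carried as a second argument, so that conditions on test functions can
  name its value at a point directly.\<close>

definition C1_fun :: "(real \<Rightarrow> real) \<Rightarrow> (real \<Rightarrow> real) \<Rightarrow> bool" where
  "C1_fun f f' \<longleftrightarrow> (\<forall>x. (f has_real_derivative f' x) (at x)) \<and> continuous_on UNIV f'"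

lemma C1_funI:
  assumes "\<And>x. (f has_real_derivative f' x) (at x)" and "continuous_on UNIV f'"
  shows "C1_fun f f'"
  using assms by (simp add: C1_fun_def)

lemma C1_fun_continuous_on:
  assumes "C1_fun f f'"
  shows "continuous_on X f"
  using assms by (intro continuous_at_imp_continuous_on ballI) (metis C1_fun_def DERIV_isCont)

text \<open>Sums \<open>\<alpha> s + \<beta> t\<close> suffice as test functions throughout, and for
  them the two partial derivatives in \<open>HJ_expr\<close> decouple. The neighborhood filter makes
  it easy to transport the condition along translations and slices.\<close>

definition touches_above ::
    "(real \<times> real \<Rightarrow> real) \<Rightarrow> (real \<Rightarrow> real) \<Rightarrow> (real \<Rightarrow> real) \<Rightarrow> real \<Rightarrow> real \<Rightarrow> bool" where
  "touches_above W \<alpha> \<beta> s t \<longleftrightarrow>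
     (\<forall>\<^sub>F z in nhds (s, t). W z - (\<alpha> (fst z) + \<beta> (snd z)) \<le> W (s, t) - (\<alpha> s + \<beta> t))"

definition touches_below ::
    "(real \<times> real \<Rightarrow> real) \<Rightarrow> (real \<Rightarrow> real) \<Rightarrow> (real \<Rightarrow> real) \<Rightarrow> real \<Rightarrow> real \<Rightarrow> bool" where
  "touches_below W \<alpha> \<beta> s t \<longleftrightarrow>
     (\<forall>\<^sub>F z in nhds (s, t). W (s, t) - (\<alpha> s + \<beta> t) \<le> W z - (\<alpha> (fst z) + \<beta> (snd z)))"

lemma C1_near_C1_fun:
  assumes "C1_fun f f'"
  shows "C1_near f x"
  unfolding C1_near_def
proof (intro exI conjI ballI)
  show "continuous_on UNIV (\<lambda>w. f' w *\<^sub>R id_blinfun)"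
    using assms by (auto simp: C1_fun_def intro!: continuous_intros)
  show "(f has_derivative blinfun_apply (f' w *\<^sub>R id_blinfun)) (at w)" for w
    using assms by (auto simp: C1_fun_def has_field_derivative_def scaleR_blinfun.rep_eq)
qed auto

lemma C1_near_separated:
  assumes "C1_fun \<alpha> \<alpha>'" and "C1_fun \<beta> \<beta>'"
  shows "C1_near (\<lambda>z. \<alpha> (fst z) + \<beta> (snd z)) z"
  unfolding C1_near_def
proof (intro exI conjI ballI)
  have cont: "continuous_on UNIV (\<lambda>w::real \<times> real. \<alpha>' (fst w))" "continuous_on UNIV (\<lambda>w::real \<times> real. \<beta>' (snd w))"
    using assms
    by (auto simp: C1_fun_def intro!: continuous_on_compose2[of UNIV \<alpha>'] continuous_on_compose2[of UNIV \<beta>'] continuous_intros)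
  then show "continuous_on UNIV
      (\<lambda>w. \<alpha>' (fst w) *\<^sub>R (fst_blinfun :: (real \<times> real) \<Rightarrow>\<^sub>L real) + \<beta>' (snd w) *\<^sub>R snd_blinfun)"
    by (intro continuous_intros)
  fix w :: "real \<times> real"
  have "((\<lambda>z. \<alpha> (fst z)) has_derivative (\<lambda>h. \<alpha>' (fst w) * fst h)) (at w)"
    by (rule has_derivative_compose[of fst fst _ _ \<alpha>])
       (use assms in \<open>auto simp: C1_fun_def has_field_derivative_def intro!: derivative_intros\<close>)
  moreover have "((\<lambda>z. \<beta> (snd z)) has_derivative (\<lambda>h. \<beta>' (snd w) * snd h)) (at w)"
    by (rule has_derivative_compose[of snd snd _ _ \<beta>])
       (use assms in \<open>auto simp: C1_fun_def has_field_derivative_def intro!: derivative_intros\<close>)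
  ultimately have "((\<lambda>z. \<alpha> (fst z) + \<beta> (snd z)) has_derivative
      (\<lambda>h. \<alpha>' (fst w) * fst h + \<beta>' (snd w) * snd h)) (at w)"
    by (rule has_derivative_add)
  then show "((\<lambda>z. \<alpha> (fst z) + \<beta> (snd z)) has_derivative
      blinfun_apply (\<alpha>' (fst w) *\<^sub>R fst_blinfun + \<beta>' (snd w) *\<^sub>R snd_blinfun)) (at w)"
    by (simp add: plus_blinfun.rep_eq scaleR_blinfun.rep_eq)
qed auto

lemma HJ_expr_separated:
  assumes "C1_fun \<alpha> \<alpha>'" and "C1_fun \<beta> \<beta>'"
  shows "HJ_expr h (\<lambda>z. \<alpha> (fst z) + \<beta> (snd z)) s t = \<beta>' t + h s (\<alpha>' s)"
proof -
  have "((\<lambda>\<tau>. \<alpha> s + \<beta> \<tau>) has_real_derivative \<beta>' t) (at t)"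
       "((\<lambda>\<sigma>. \<alpha> \<sigma> + \<beta> t) has_real_derivative \<alpha>' s) (at s)"
    using assms by (auto simp: C1_fun_def intro!: derivative_eq_intros)
  then show ?thesis
    by (simp add: HJ_expr_def DERIV_imp_deriv)
qed

lemma eventually_nhds_ball:
  fixes z :: "'z::metric_space"
  shows "eventually P (nhds z) \<longleftrightarrow> (\<exists>\<epsilon>>0. \<forall>w\<in>ball z \<epsilon>. P w)"
  by (simp add: eventually_nhds_metric dist_commute Ball_def)

lemma visc_subsolD:
  assumes "visc_subsol h T0 T1 w" and "0 < s" "s < 1" and "t \<in> open_time T0 T1"
    and "C1_fun \<alpha> \<alpha>'" and "C1_fun \<beta> \<beta>'" and "touches_above w \<alpha> \<beta> s t"
  shows "\<beta>' t + h s (\<alpha>' s) \<le> 0"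
proof -
  have "supertangent UNIV w (s, t) (\<lambda>z. \<alpha> (fst z) + \<beta> (snd z))"
    using assms(7) C1_near_separated[OF assms(5,6)]
    by (simp add: supertangent_def touches_above_def eventually_nhds_ball)
  with assms(1-4) have "HJ_expr h (\<lambda>z. \<alpha> (fst z) + \<beta> (snd z)) s t \<le> 0"
    by (simp add: visc_subsol_def)
  then show ?thesis
    by (simp add: HJ_expr_separated[OF assms(5,6)])
qed

lemma visc_supersolD:
  assumes "visc_supersol h T0 T1 w" and "0 < s" "s < 1" and "t \<in> open_time T0 T1"
    and "C1_fun \<alpha> \<alpha>'" and "C1_fun \<beta> \<beta>'" and "touches_below w \<alpha> \<beta> s t"
  shows "\<beta>' t + h s (\<alpha>' s) \<ge> 0"
proof -
  have "subtangent UNIV w (s, t) (\<lambda>z. \<alpha> (fst z) + \<beta> (snd z))"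
    using assms(7) C1_near_separated[OF assms(5,6)]
    by (simp add: subtangent_def touches_below_def eventually_nhds_ball)
  with assms(1-4) have "HJ_expr h (\<lambda>z. \<alpha> (fst z) + \<beta> (snd z)) s t \<ge> 0"
    by (simp add: visc_supersol_def)
  then show ?thesis
    by (simp add: HJ_expr_separated[OF assms(5,6)])
qed

lemma eventually_nhds_box:
  fixes s t :: real
  assumes "\<And>s' t'. s' \<in> {a<..<b} \<Longrightarrow> t' \<in> {c<..<d} \<Longrightarrow> P (s', t')"
    and "s \<in> {a<..<b}" "t \<in> {c<..<d}"
  shows "eventually P (nhds (s, t))"
proof -
  have "open ({a<..<b} \<times> {c<..<d})" by (intro open_Times) auto
  with assms show ?thesis by (auto simp: eventually_nhds)
qed

section \<open>Slope bounds in space obtained from test functions\<close>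

text \<open>
  Suppose \<open>W(\<cdot>, t0)\<close> increased faster than \<open>P\<close> between \<open>s1\<close> and \<open>s2\<close>. The steep exponential
  pushes a maximum of \<open>W - P s\<close> away from \<open>s3\<close>, and since it is increasing it touches \<open>W\<close> with
  slope greater than \<open>P\<close>.
\<close>

lemma slope_bound:
  fixes W :: "real \<times> real \<Rightarrow> real"
  assumes s: "s1 < s2" "s2 < s3" and "\<rho> > 0"
    and cont: "continuous_on ({s1..s3} \<times> {t0 - \<rho>..t0 + \<rho>}) W"
    and test: "\<And>\<alpha> \<alpha>' \<beta> \<beta>' s t. \<lbrakk>s \<in> {s1<..<s3}; t \<in> {t0 - \<rho><..<t0 + \<rho>};
        C1_fun \<alpha> \<alpha>'; C1_fun \<beta> \<beta>'; touches_above W \<alpha> \<beta> s t\<rbrakk> \<Longrightarrow> \<alpha>' s \<le> P"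
  shows "W (s2, t0) - W (s1, t0) \<le> P * (s2 - s1)"
proof (rule ccontr)
  assume neg: "\<not> ?thesis"
  define G where "G = (\<lambda>z. W z - P * fst z)"
  \<comment> \<open>One third of the excess pays for the exponential at \<open>s2\<close>, one third
    for the oscillation of \<open>G\<close> near \<open>(s1, t0)\<close>; the last third is the
    contradiction at the edge \<open>s = s1\<close>.\<close>
  define \<sigma> where "\<sigma> = (G (s2, t0) - G (s1, t0)) / 3"
  have \<sigma>: "\<sigma> > 0" "G (s2, t0) = G (s1, t0) + 3 * \<sigma>"
  proof -
    have "G (s2, t0) - G (s1, t0) > 0"
      using neg by (simp add: G_def algebra_simps)
    moreover have "3 * \<sigma> = G (s2, t0) - G (s1, t0)"
      by (simp add: \<sigma>_def)
    ultimately show "\<sigma> > 0" "G (s2, t0) = G (s1, t0) + 3 * \<sigma>" by linarith+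
  qed
  let ?R = "{s1..s3} \<times> {t0 - \<rho>..t0 + \<rho>}"
  have contG: "continuous_on ?R G"
    unfolding G_def by (intro continuous_intros cont)
  have "compact (G ` ?R)"
    by (intro compact_continuous_image contG compact_Times) auto
  then obtain C where C: "C > 0" "\<And>z. z \<in> ?R \<Longrightarrow> \<bar>G z\<bar> \<le> C"
    by (metis (no_types, lifting) bounded_pos compact_imp_bounded image_eqI real_norm_def)
  obtain d where d: "d > 0" "\<And>z. z \<in> ?R \<Longrightarrow> dist z (s1, t0) < d \<Longrightarrow> dist (G z) (G (s1, t0)) < \<sigma>"
    using contG[unfolded continuous_on_iff, rule_format, of "(s1, t0)" \<sigma>] s \<open>\<rho> > 0\<close> \<sigma> by auto
  define \<rho>' where "\<rho>' = min (\<rho> / 2) (d / 2)"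
  have \<rho>': "0 < \<rho>'" "\<rho>' < \<rho>" "\<rho>' < d"
    using d \<open>\<rho> > 0\<close> by (auto simp: \<rho>'_def)
  \<comment> \<open>\<open>K\<close> makes the exponential at \<open>s3\<close>, and
    \<open>K2\<close> the parabola at \<open>\<bar>t - t0\<bar> = \<rho>'\<close>, exceed the
    oscillation \<open>2 * C\<close> of \<open>G\<close> by more than \<open>\<sigma>\<close>. Since
    \<open>F\<close> is at least \<open>G (s2, t0) - \<sigma>\<close> at its maximum, no maximizer
    lies on these edges.\<close>
  define K where "K = (2 * C + 1) / (\<sigma> * (s3 - s2))"
  define K2 where "K2 = (2 * C + \<sigma> + 1) / \<rho>'\<^sup>2"
  have K: "K > 0" using C \<sigma> s by (simp add: K_def)
  have "\<sigma> * exp (K * (s3 - s2)) \<ge> \<sigma> * (1 + K * (s3 - s2))"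
    using \<sigma> by (intro mult_left_mono exp_ge_add_one_self) auto
  also have "\<sigma> * (1 + K * (s3 - s2)) = \<sigma> + 2 * C + 1"
    using \<sigma> s by (simp add: K_def field_simps)
  finally have K3: "\<sigma> * exp (K * (s3 - s2)) \<ge> \<sigma> + 2 * C + 1" .
  have K2: "K2 > 0" "K2 * \<rho>'\<^sup>2 = 2 * C + \<sigma> + 1"
    using C \<sigma> \<rho>' by (auto simp: K2_def)
  define \<alpha> where "\<alpha> = (\<lambda>s. P * s + \<sigma> * exp (K * (s - s2)))"
  define \<alpha>' where "\<alpha>' = (\<lambda>s. P + \<sigma> * K * exp (K * (s - s2)))"
  define \<beta> where "\<beta> = (\<lambda>t. K2 * (t - t0)\<^sup>2)"
  define \<beta>' where "\<beta>' = (\<lambda>t. 2 * K2 * (t - t0))"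
  have C1: "C1_fun \<alpha> \<alpha>'" "C1_fun \<beta> \<beta>'"
    unfolding \<alpha>_def \<alpha>'_def \<beta>_def \<beta>'_def
    by (auto intro!: C1_funI derivative_eq_intros continuous_intros simp: algebra_simps)
  define F where "F = (\<lambda>z. W z - (\<alpha> (fst z) + \<beta> (snd z)))"
  let ?R' = "{s1..s3} \<times> {t0 - \<rho>'..t0 + \<rho>'}"
  have sub: "?R' \<subseteq> ?R" using \<rho>' by auto
  have "continuous_on ?R' F"
    unfolding F_def \<alpha>_def \<beta>_def
    by (intro continuous_intros continuous_on_subset[OF cont sub])
  moreover have "compact ?R'" by (intro compact_Times) auto
  moreover have "?R' \<noteq> {}" using s \<rho>' by auto
  ultimately obtain z where z: "z \<in> ?R'" "\<And>y. y \<in> ?R' \<Longrightarrow> F y \<le> F z"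
    using continuous_attains_sup by metis
  obtain s t where st: "z = (s, t)" by (cases z)
  have Fz: "F (s, t) = G (s, t) - \<sigma> * exp (K * (s - s2)) - K2 * (t - t0)\<^sup>2"
    by (simp add: F_def G_def \<alpha>_def \<beta>_def)
  have base: "F (s, t) \<ge> G (s2, t0) - \<sigma>"
    using z(2)[of "(s2, t0)"] s \<rho>' by (simp add: st F_def G_def \<alpha>_def \<beta>_def)
  have G0: "G (s2, t0) \<ge> - C" using C(2)[of "(s2, t0)"] s \<open>\<rho> > 0\<close> by auto
  have G1: "G (s, t) \<le> C" using C(2)[of "(s, t)"] z(1) \<rho>' by (auto simp: st)
  have pos: "\<sigma> * exp (K * (s - s2)) > 0" "K2 * (t - t0)\<^sup>2 \<ge> 0"
    using \<sigma> K2 by auto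
  have "s \<noteq> s1"
  proof
    assume "s = s1"
    with z(1) sub have "dist (G (s1, t)) (G (s1, t0)) < \<sigma>"
      using \<rho>' by (intro d(2)) (auto simp: st dist_Pair_Pair dist_real_def)
    then have "G (s, t) < G (s1, t0) + \<sigma>"
      using \<open>s = s1\<close> by (simp add: dist_real_def)
    with Fz base pos \<sigma> show False by linarith
  qed
  moreover have "s \<noteq> s3"
    using K3 Fz base pos G0 G1 by auto
  moreover have "\<bar>t - t0\<bar> \<noteq> \<rho>'"
  proof
    assume "\<bar>t - t0\<bar> = \<rho>'"
    then have "K2 * (t - t0)\<^sup>2 = 2 * C + \<sigma> + 1"
      using K2 by (metis power2_abs)
    with Fz base pos G0 G1 show False by auto
  qed
  ultimately have int: "s \<in> {s1<..<s3}" "t \<in> {t0 - \<rho>'<..<t0 + \<rho>'}"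
    using z(1) by (auto simp: st)
  have "touches_above W \<alpha> \<beta> s t"
    unfolding touches_above_def
    by (rule eventually_nhds_box[OF _ int])
       (use z(2) in \<open>auto simp: F_def st\<close>)
  then have "\<alpha>' s \<le> P"
    using int \<rho>' C1 by (intro test) auto
  then show False
    using \<sigma> K by (simp add: \<alpha>'_def mult_le_0_iff)
qed

text \<open>The test condition covers only \<open>s < 1\<close>, and \<open>slope_bound\<close>
  needs a margin to the right of its second point. It is therefore applied up to
  \<open>x < 1\<close>, with the midpoint of \<open>x\<close> and 1 as margin, and continuity gives
  the limit \<open>x = 1\<close>.\<close>

lemma boundary_slope_bound:
  fixes W :: "real \<times> real \<Rightarrow> real"
  assumes cont: "continuous_on ({1 - \<rho>..1} \<times> {t0 - \<rho>..t0 + \<rho>}) W"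
    and test: "\<And>\<alpha> \<alpha>' \<beta> \<beta>' s t. \<lbrakk>s \<in> {1 - \<rho><..<1}; t \<in> {t0 - \<rho><..<t0 + \<rho>};
        C1_fun \<alpha> \<alpha>'; C1_fun \<beta> \<beta>'; touches_above W \<alpha> \<beta> s t\<rbrakk> \<Longrightarrow> \<alpha>' s \<le> P"
    and s: "s \<in> {1 - \<rho>..1}" and t: "t \<in> {t0 - \<rho><..<t0 + \<rho>}"
  shows "W (1, t) + P * (s - 1) \<le> W (s, t)"
proof (cases "s = 1")
  case False
  with s have "s < 1" by simp
  \<comment> \<open>Half the distance from \<open>t\<close> to the edge of the time window, so that
    a window centred at \<open>t\<close> fits inside.\<close>
  define r where "r = (\<rho> - \<bar>t - t0\<bar>) / 2"
  have r: "r > 0" "{t - r..t + r} \<subseteq> {t0 - \<rho><..<t0 + \<rho>}"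
    using t by (auto simp: r_def field_simps abs_if split: if_splits)
  have le: "W (x, t) \<le> W (s, t) + P * (x - s)" if x: "x \<in> {s<..<1}" for x
  proof -
    define s3 where "s3 = (x + 1) / 2"
    have s3: "x < s3" "s3 < 1" using x by (auto simp: s3_def)
    have "W (x, t) - W (s, t) \<le> P * (x - s)"
    proof (rule slope_bound[of s x s3 r t W P])
      show "continuous_on ({s..s3} \<times> {t - r..t + r}) W"
        by (rule continuous_on_subset[OF cont]) (use s s3 r in auto)
      fix \<alpha> \<alpha>' \<beta> \<beta>' s' t'
      assume *: "s' \<in> {s<..<s3}" "t' \<in> {t - r<..<t + r}"
        "C1_fun \<alpha> \<alpha>'" "C1_fun \<beta> \<beta>'" "touches_above W \<alpha> \<beta> s' t'"
      have "t' \<in> {t - r..t + r}" using *(2) by auto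
      with r have "t' \<in> {t0 - \<rho><..<t0 + \<rho>}" by blast
      with * s s3 show "\<alpha>' s' \<le> P" by (intro test[of s' t' \<alpha> \<alpha>' \<beta> \<beta>']) auto
    qed (use x s3 r in auto)
    then show ?thesis by simp
  qed
  have "continuous_on {s..1} (\<lambda>x. W (x, t))"
    by (rule continuous_on_compose2[OF cont]) (use s t in \<open>auto intro!: continuous_intros\<close>)
  then have "((\<lambda>x. W (x, t)) \<longlongrightarrow> W (1, t)) (at_left 1)"
    using \<open>s < 1\<close> continuous_on_Icc_at_leftD by blast
  moreover have "((\<lambda>x. W (s, t) + P * (x - s)) \<longlongrightarrow> W (s, t) + P * (1 - s)) (at_left 1)"
    by (intro tendsto_intros)
  moreover have "\<forall>\<^sub>F x in at_left 1. W (x, t) \<le> W (s, t) + P * (x - s)"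
    using eventually_at_left_real[OF \<open>s < 1\<close>] le by (auto elim: eventually_mono)
  ultimately have "W (1, t) \<le> W (s, t) + P * (1 - s)"
    by (intro tendsto_le[of "at_left (1::real)"]) auto
  then show ?thesis by (simp add: algebra_simps)
qed simp

section \<open>Stability of sublevel sets and of maximizers\<close>

text \<open>\<open>P\<close> is taken slightly to the right of the largest momentum \<open>q\<close>
  with \<open>h 1 q \<le> b1\<close>, where \<open>b < b1 < b'\<close>. The gap from
  \<open>b1\<close> to \<open>b'\<close> allows this step to the right; the gap from
  \<open>b\<close> to \<open>b1\<close> allows \<open>s\<close> to leave 1, by uniform continuity
  for momenta in \<open>{P..max P R}\<close> and by coercivity beyond.\<close>

lemma sublevel_bound:
  fixes h :: "real \<Rightarrow> real \<Rightarrow> real"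
  assumes cont: "continuous_on ({0..1} \<times> UNIV) (\<lambda>(s, p). h s p)"
    and coercive: "\<forall>K. \<exists>R. \<forall>s\<in>{0..1}. \<forall>p. \<bar>p\<bar> \<ge> R \<longrightarrow> h s p \<ge> K"
    and p0: "h 1 p0 < b'" and "b < b'"
  obtains P \<rho> where "\<rho> > 0" "h 1 P < b'"
    "\<And>s p. s \<in> {0..1} \<Longrightarrow> 1 - \<rho> < s \<Longrightarrow> h s p \<le> b \<Longrightarrow> p \<le> P"
proof -
  obtain b1 where b1: "b < b1" "h 1 p0 < b1" "b1 < b'"
    using dense[of "max b (h 1 p0)" b'] p0 \<open>b < b'\<close> by auto
  obtain R where R: "\<And>s p. s \<in> {0..1} \<Longrightarrow> \<bar>p\<bar> \<ge> R \<Longrightarrow> h s p \<ge> b1 + 1"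
    using coercive by metis
  have "continuous_on UNIV (\<lambda>p. (\<lambda>(s, p). h s p) (1, p))"
    by (rule continuous_on_compose2[OF cont], intro continuous_intros) auto
  then have cont1: "continuous_on UNIV (h 1)" by simp
  define S where "S = {p. h 1 p \<le> b1}"
  have "closed S"
    unfolding S_def by (intro closed_Collect_le cont1 continuous_intros)
  moreover have "bounded S"
  proof -
    have "\<bar>p\<bar> \<le> R" if "p \<in> S" for p
      using R[of 1 p] that by (cases "R \<le> \<bar>p\<bar>") (auto simp: S_def)
    then show ?thesis by (auto simp: bounded_iff)
  qed
  ultimately have "compact S" by (simp add: compact_eq_bounded_closed)
  moreover have "p0 \<in> S" using b1 by (simp add: S_def)
  then have "S \<noteq> {}" by blast
  ultimately obtain q where q: "q \<in> S" "\<And>p. p \<in> S \<Longrightarrow> p \<le> q"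
    using compact_attains_sup by metis
  have "open {p. h 1 p < b'}"
    by (intro open_Collect_less cont1 continuous_intros)
  moreover have "q \<in> {p. h 1 p < b'}" using q b1 by (auto simp: S_def)
  ultimately obtain e where e: "e > 0" "ball q e \<subseteq> {p. h 1 p < b'}"
    by (meson openE)
  define P where "P = q + e / 2"
  have P: "h 1 P < b'" using e by (auto simp: P_def dist_real_def subset_eq)
  have big: "h 1 p > b1" if "p \<ge> P" for p
    using q(2)[of p] that e by (force simp: S_def P_def)
  have "uniformly_continuous_on ({0..1} \<times> {P..max P R}) (\<lambda>(s, p). h s p)"
    by (intro compact_uniformly_continuous compact_Times continuous_on_subset[OF cont]) auto
  then obtain \<rho> where \<rho>: "\<rho> > 0" and uc: "\<And>y z. \<lbrakk>y \<in> {0..1} \<times> {P..max P R};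
      z \<in> {0..1} \<times> {P..max P R}; dist z y < \<rho>\<rbrakk>
      \<Longrightarrow> dist ((\<lambda>(s, p). h s p) z) ((\<lambda>(s, p). h s p) y) < b1 - b"
    using b1 unfolding uniformly_continuous_on_def by (metis diff_gt_0_iff_gt)
  have "p \<le> P" if "s \<in> {0..1}" "1 - \<rho> < s" "h s p \<le> b" for s p
  proof (rule ccontr)
    assume "\<not> p \<le> P"
    then have "p \<ge> P" by simp
    show False
    proof (cases "p \<le> max P R")
      case True
      with that \<open>p \<ge> P\<close> uc[of "(1, p)" "(s, p)"] have "\<bar>h s p - h 1 p\<bar> < b1 - b"
        by (auto simp: dist_Pair_Pair dist_real_def)
      with big[OF \<open>p \<ge> P\<close>] that show False by auto
    next
      case False
      then have "R \<le> \<bar>p\<bar>" by linarith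
      with R[of s p] that b1 show False by auto
    qed
  qed
  with \<rho> P show thesis by (intro that) auto
qed

text \<open>As \<open>r0\<close> is the least maximizer at \<open>z0\<close>, the values of
  \<open>f z0\<close> on \<open>{A..r0 - e}\<close> stay below the maximum by a fixed gap, which
  survives small changes of \<open>z\<close>. The bound is one-sided: maximizers may still jump to
  the right of \<open>r0\<close>.\<close>

lemma argmax_lower_bound:
  fixes f :: "'z::metric_space \<Rightarrow> real \<Rightarrow> real"
  assumes "compact X" and cont: "continuous_on (X \<times> {A..B}) (\<lambda>(z, r). f z r)"
    and "z0 \<in> X" and r0: "r0 \<in> {A..B}"
    and max: "\<And>r. r \<in> {A..B} \<Longrightarrow> f z0 r \<le> f z0 r0"
    and least: "\<And>r. r \<in> {A..B} \<Longrightarrow> f z0 r = f z0 r0 \<Longrightarrow> r0 \<le> r"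
    and "e > 0"
  obtains d where "d > 0"
    "\<And>z r. \<lbrakk>z \<in> X; dist z z0 < d; r \<in> {A..B}; \<And>r'. r' \<in> {A..B} \<Longrightarrow> f z r' \<le> f z r\<rbrakk> \<Longrightarrow> r0 - e < r"
proof (cases "A \<le> r0 - e")
  case False
  show thesis by (rule that[of 1]) (use False in auto)
next
  case True
  have "continuous_on {A..r0 - e} (\<lambda>r. (\<lambda>(z, r). f z r) (z0, r))"
    by (rule continuous_on_compose2[OF cont], intro continuous_intros)
       (use \<open>z0 \<in> X\<close> r0 \<open>e > 0\<close> in auto)
  then have "continuous_on {A..r0 - e} (f z0)" by simp
  then obtain r1 where r1: "r1 \<in> {A..r0 - e}" "\<And>r. r \<in> {A..r0 - e} \<Longrightarrow> f z0 r \<le> f z0 r1"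
    using continuous_attains_sup[of "{A..r0 - e}" "f z0"] True by auto
  \<comment> \<open>The gap is positive because \<open>r1 < r0\<close> cannot be a maximizer. Two
    values are perturbed in the comparison, hence the tolerance \<open>g / 2\<close>.\<close>
  define g where "g = f z0 r0 - f z0 r1"
  have "g > 0"
    using max[of r1] least[of r1] r1(1) r0 \<open>e > 0\<close> by (force simp: g_def)
  have "uniformly_continuous_on (X \<times> {A..B}) (\<lambda>(z, r). f z r)"
    by (intro compact_uniformly_continuous compact_Times cont \<open>compact X\<close>) auto
  then obtain d where d: "d > 0" and uc: "\<And>y z. \<lbrakk>y \<in> X \<times> {A..B}; z \<in> X \<times> {A..B}; dist z y < d\<rbrakk>
      \<Longrightarrow> dist ((\<lambda>(z, r). f z r) z) ((\<lambda>(z, r). f z r) y) < g / 2"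
    using \<open>g > 0\<close> unfolding uniformly_continuous_on_def by (metis half_gt_zero)
  show thesis
  proof (rule that[OF d])
    fix z r
    assume z: "z \<in> X" "dist z z0 < d" and r: "r \<in> {A..B}"
      and zmax: "\<And>r'. r' \<in> {A..B} \<Longrightarrow> f z r' \<le> f z r"
    have close: "\<bar>f z r' - f z0 r'\<bar> < g / 2" if "r' \<in> {A..B}" for r'
      using uc[of "(z0, r')" "(z, r')"] z \<open>z0 \<in> X\<close> that
      by (auto simp: dist_Pair_Pair dist_real_def)
    show "r0 - e < r"
    proof (rule ccontr)
      assume "\<not> ?thesis"
      then have "f z0 r \<le> f z0 r1" using r by (intro r1) auto
      with close[OF r] close[OF r0] zmax[OF r0] show False
        unfolding g_def abs_less_iff by (simp add: field_simps)
    qed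
  qed
qed

section \<open>Doubling of variables in the interior of an arc\<close>

text \<open>Both test functions have the momentum \<open>2 * n * (s - r)\<close> and the time slope
  \<open>2 * n * (t - \<tau>)\<close> in common, so subtracting the two inequalities leaves
  \<open>\<theta>' t\<close> plus small errors, which cannot be nonpositive. The bound
  \<open>B\<close> is what the sup-convolution contributes.\<close>

lemma no_interior_maximum:
  fixes W V :: "real \<times> real \<Rightarrow> real" and h :: "real \<Rightarrow> real \<Rightarrow> real"
  assumes hcont: "continuous_on ({0..1} \<times> UNIV) (\<lambda>(s, p). h s p)"
    and coercive: "\<forall>K. \<exists>R. \<forall>s\<in>{0..1}. \<forall>p. \<bar>p\<bar> \<ge> R \<longrightarrow> h s p \<ge> K"
    and \<rho>: "\<rho> > 0" "0 < s0 - \<rho>" "s0 + \<rho> < 1"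
    and \<theta>: "C1_fun \<theta> \<theta>'" "\<theta>' t0 > 0"
    and contW: "continuous_on ({s0 - \<rho>..s0 + \<rho>} \<times> {t0 - \<rho>..t0 + \<rho>}) W"
    and contV: "continuous_on ({s0 - \<rho>..s0 + \<rho>} \<times> {t0 - \<rho>..t0 + \<rho>}) V"
    and sub: "\<And>\<alpha> \<alpha>' \<beta> \<beta>' s t. \<lbrakk>s \<in> {s0 - \<rho><..<s0 + \<rho>}; t \<in> {t0 - \<rho><..<t0 + \<rho>};
        C1_fun \<alpha> \<alpha>'; C1_fun \<beta> \<beta>'; touches_above W \<alpha> \<beta> s t\<rbrakk>
        \<Longrightarrow> \<beta>' t + h s (\<alpha>' s) \<le> 0 \<and> \<bar>\<beta>' t\<bar> \<le> B"
    and super: "\<And>\<alpha> \<alpha>' \<beta> \<beta>' s t. \<lbrakk>s \<in> {s0 - \<rho><..<s0 + \<rho>}; t \<in> {t0 - \<rho><..<t0 + \<rho>};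
        C1_fun \<alpha> \<alpha>'; C1_fun \<beta> \<beta>'; touches_below V \<alpha> \<beta> s t\<rbrakk> \<Longrightarrow> \<beta>' t + h s (\<alpha>' s) \<ge> 0"
    and max: "\<And>s t. \<lbrakk>s \<in> {s0 - \<rho>..s0 + \<rho>}; t \<in> {t0 - \<rho>..t0 + \<rho>}\<rbrakk>
        \<Longrightarrow> W (s, t) - V (s, t) - \<theta> t \<le> W (s0, t0) - V (s0, t0) - \<theta> t0"
  shows False
proof -
  \<comment> \<open>A quarter, because three errors below \<open>\<eta>\<close> are subtracted from
    \<open>\<theta>' t0\<close>: from the Hamiltonian, from \<open>\<theta>'\<close>, and from the
    quadratic term in time.\<close>
  define \<eta> where "\<eta> = \<theta>' t0 / 4"
  have \<eta>: "\<eta> > 0" "\<theta>' t0 = 4 * \<eta>" using \<theta> by (auto simp: \<eta>_def)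
  obtain R where R: "\<And>s p. s \<in> {0..1} \<Longrightarrow> \<bar>p\<bar> \<ge> R \<Longrightarrow> h s p \<ge> B + 1"
    using coercive by metis
  have "uniformly_continuous_on ({0..1} \<times> {-(R + 2)..R + 2}) (\<lambda>(s, p). h s p)"
    by (intro compact_uniformly_continuous compact_Times continuous_on_subset[OF hcont]) auto
  then obtain d1 where d1: "d1 > 0" and uc1: "\<And>y z. \<lbrakk>y \<in> {0..1} \<times> {-(R + 2)..R + 2};
      z \<in> {0..1} \<times> {-(R + 2)..R + 2}; dist z y < d1\<rbrakk>
      \<Longrightarrow> dist ((\<lambda>(s, p). h s p) z) ((\<lambda>(s, p). h s p) y) < \<eta>"
    using \<eta> unfolding uniformly_continuous_on_def by metis
  have "isCont \<theta>' t0"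
    using \<theta>(1) by (simp add: C1_fun_def continuous_on_eq_continuous_at)
  then obtain d2 where d2: "d2 > 0" "\<And>t. \<bar>t - t0\<bar> < d2 \<Longrightarrow> \<bar>\<theta>' t - \<theta>' t0\<bar> < \<eta>"
    using \<eta> by (metis continuous_at_eps_delta dist_real_def)
  \<comment> \<open>\<open>e\<close> bounds the distance of the maximizer from
    \<open>(s0, t0)\<close> and from its double. Its entries keep both points inside the box, keep
    the momentum shift \<open>2 * (s - s0)\<close> within 2, keep the arguments of \<open>h\<close>
    within \<open>d1\<close>, and make the two time errors smaller than
    \<open>\<eta>\<close>.\<close>
  define e where "e = Min {\<rho> / 3, 1, d1 / 4, d2, \<eta> / 2}"
  have e: "e > 0" "e \<le> \<rho> / 3" "e \<le> 1" "e \<le> d1 / 4" "e \<le> d2" "e \<le> \<eta> / 2"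
    using \<rho> \<eta> d1 d2 by (auto simp: e_def)
  define K where "K = {s0 - \<rho>..s0 + \<rho>} \<times> {t0 - \<rho>..t0 + \<rho>}"
  have K: "compact K" "(s0, t0) \<in> K" unfolding K_def using \<rho> by (auto intro: compact_Times)
  have "uniformly_continuous_on K V"
    using contV K by (intro compact_uniformly_continuous) (auto simp: K_def)
  then obtain d3 where d3: "d3 > 0" and uc3: "\<And>y z. \<lbrakk>y \<in> K; z \<in> K; dist z y < d3\<rbrakk> \<Longrightarrow> dist (V z) (V y) < e\<^sup>2"
    using e unfolding uniformly_continuous_on_def by (metis zero_less_power)
  have "compact (V ` K)"
    using contV K by (intro compact_continuous_image) (auto simp: K_def)
  then obtain C where C: "C > 0" "\<And>z. z \<in> K \<Longrightarrow> \<bar>V z\<bar> \<le> C"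
    by (metis (no_types, lifting) bounded_pos compact_imp_bounded image_eqI real_norm_def)
  define d where "d = min d3 e"
  have d: "d > 0" "d \<le> d3" "d \<le> e" using d3 e by (auto simp: d_def)
  \<comment> \<open>A separation of \<open>d\<close> or more would cost \<open>2 * C + 1\<close>,
    more than the oscillation of \<open>V\<close> allows.\<close>
  define n where "n = (2 * C + 1) / d\<^sup>2"
  have n: "n > 0" "n * d\<^sup>2 = 2 * C + 1" using C d by (auto simp: n_def)
  \<comment> \<open>The maximum at \<open>(s0, t0)\<close> need not be strict; the two squares
    centred there force the maximizers of \<open>\<Phi>\<close> to lie close to it.\<close>
  define \<Phi> where "\<Phi> = (\<lambda>(z, y). W z - V y - \<theta> (snd z) - (fst z - s0)\<^sup>2 - (snd z - t0)\<^sup>2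
    - n * ((fst z - fst y)\<^sup>2 + (snd z - snd y)\<^sup>2))"
  have c1: "continuous_on (K \<times> K) (\<lambda>x. W (fst x))"
    by (rule continuous_on_compose2[OF contW]) (auto simp: K_def intro!: continuous_on_fst continuous_on_id)
  have c2: "continuous_on (K \<times> K) (\<lambda>x. V (snd x))"
    by (rule continuous_on_compose2[OF contV]) (auto simp: K_def intro!: continuous_on_snd continuous_on_id)
  have c3: "continuous_on (K \<times> K) (\<lambda>x. \<theta> (snd (fst x)))"
    by (rule continuous_on_compose2[OF C1_fun_continuous_on[OF \<theta>(1), of UNIV]])
       (auto intro!: continuous_on_fst continuous_on_snd continuous_on_id)
  have "continuous_on (K \<times> K) \<Phi>"
    unfolding \<Phi>_def case_prod_unfold by (intro continuous_intros c1 c2 c3)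
  moreover have "K \<times> K \<noteq> {}" using K by auto
  ultimately obtain zy where zy: "zy \<in> K \<times> K" "\<And>x. x \<in> K \<times> K \<Longrightarrow> \<Phi> x \<le> \<Phi> zy"
    using continuous_attains_sup[of "K \<times> K" \<Phi>] K(1) compact_Times by metis
  obtain s t r \<tau> where st: "zy = ((s, t), (r, \<tau>))" by (metis surj_pair)
  have inK: "(s, t) \<in> K" "(r, \<tau>) \<in> K" using zy by (auto simp: st)
  have M: "\<Phi> ((s', t'), (r', \<tau>')) \<le> \<Phi> ((s, t), (r, \<tau>))" if "(s', t') \<in> K" "(r', \<tau>') \<in> K" for s' t' r' \<tau>'
    using zy(2)[of "((s', t'), (r', \<tau>'))"] that by (simp add: st)
  have \<Phi>: "\<Phi> ((s', t'), (r', \<tau>')) = W (s', t') - V (r', \<tau>') - \<theta> t' - (s' - s0)\<^sup>2 - (t' - t0)\<^sup>2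
    - n * ((s' - r')\<^sup>2 + (t' - \<tau>')\<^sup>2)" for s' t' r' \<tau>'
    by (simp add: \<Phi>_def)
  have m1: "W (s, t) - V (s, t) - \<theta> t \<le> W (s0, t0) - V (s0, t0) - \<theta> t0"
    using max inK by (auto simp: K_def)
  have m2: "W (s0, t0) - V (s0, t0) - \<theta> t0 \<le> \<Phi> ((s, t), (r, \<tau>))"
    using M[OF K(2) K(2)] by (simp add: \<Phi>)
  \<comment> \<open>Comparison with the diagonal point over \<open>(s0, t0)\<close> leaves only an
    increment of \<open>V\<close>. It is used twice: the crude bound \<open>2 * C\<close> brings the
    doubled points within \<open>d\<close>, then uniform continuity of \<open>V\<close> makes the
    increment less than the square of \<open>e\<close>.\<close>
  have m3: "n * ((s - r)\<^sup>2 + (t - \<tau>)\<^sup>2) + (s - s0)\<^sup>2 + (t - t0)\<^sup>2 \<le> V (s, t) - V (r, \<tau>)"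
    using m1 m2 by (simp add: \<Phi>)
  have "V (s, t) - V (r, \<tau>) \<le> 2 * C"
    using C(2)[OF inK(1)] C(2)[OF inK(2)] by linarith
  then have "n * ((s - r)\<^sup>2 + (t - \<tau>)\<^sup>2) < n * d\<^sup>2"
    using m3 n zero_le_power2[of "s - s0"] zero_le_power2[of "t - t0"] by linarith
  then have dd: "(s - r)\<^sup>2 + (t - \<tau>)\<^sup>2 < d\<^sup>2"
    using n(1) by (simp only: mult_less_cancel_left_pos)
  then have dist: "dist (s, t) (r, \<tau>) < d"
    using d by (simp add: dist_Pair_Pair dist_real_def real_less_lsqrt)
  have "\<bar>s - r\<bar>\<^sup>2 < d\<^sup>2" "\<bar>t - \<tau>\<bar>\<^sup>2 < d\<^sup>2"
    using dd zero_le_power2[of "s - r"] zero_le_power2[of "t - \<tau>"] by (simp_all only: power2_abs)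
  then have sr: "\<bar>s - r\<bar> < d" "\<bar>t - \<tau>\<bar> < d"
    using d by (meson less_imp_le power2_less_imp_less)+
  have "dist (V (s, t)) (V (r, \<tau>)) < e\<^sup>2"
    using dist d inK by (intro uc3) auto
  then have "(s - s0)\<^sup>2 + (t - t0)\<^sup>2 < e\<^sup>2"
    using m3 n by (smt (verit) dist_real_def mult_nonneg_nonneg zero_le_power2)
  then have "\<bar>s - s0\<bar>\<^sup>2 < e\<^sup>2" "\<bar>t - t0\<bar>\<^sup>2 < e\<^sup>2"
    using zero_le_power2[of "s - s0"] zero_le_power2[of "t - t0"] by (simp_all only: power2_abs)
  then have s0t0: "\<bar>s - s0\<bar> < e" "\<bar>t - t0\<bar> < e"
    using e by (meson less_imp_le power2_less_imp_less)+
  have int: "s \<in> {s0 - \<rho><..<s0 + \<rho>}" "t \<in> {t0 - \<rho><..<t0 + \<rho>}"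
      "r \<in> {s0 - \<rho><..<s0 + \<rho>}" "\<tau> \<in> {t0 - \<rho><..<t0 + \<rho>}"
    using s0t0 sr d e \<rho> unfolding greaterThanLessThan_iff by linarith+
  define p where "p = 2 * n * (s - r)"
  have u1: "(\<theta>' t + 2 * (t - t0) + 2 * n * (t - \<tau>)) + h s (2 * (s - s0) + 2 * n * (s - r)) \<le> 0
      \<and> \<bar>\<theta>' t + 2 * (t - t0) + 2 * n * (t - \<tau>)\<bar> \<le> B"
  proof (rule sub[OF int(1,2), of "\<lambda>x. (x - s0)\<^sup>2 + n * (x - r)\<^sup>2" "\<lambda>x. 2 * (x - s0) + 2 * n * (x - r)"
        "\<lambda>y. \<theta> y + (y - t0)\<^sup>2 + n * (y - \<tau>)\<^sup>2" "\<lambda>y. \<theta>' y + 2 * (y - t0) + 2 * n * (y - \<tau>)"])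
    show "C1_fun (\<lambda>x. (x - s0)\<^sup>2 + n * (x - r)\<^sup>2) (\<lambda>x. 2 * (x - s0) + 2 * n * (x - r))"
      by (auto intro!: C1_funI derivative_eq_intros continuous_intros simp: algebra_simps)
    show "C1_fun (\<lambda>y. \<theta> y + (y - t0)\<^sup>2 + n * (y - \<tau>)\<^sup>2) (\<lambda>y. \<theta>' y + 2 * (y - t0) + 2 * n * (y - \<tau>))"
      using \<theta>(1) unfolding C1_fun_def
      by (auto intro!: derivative_eq_intros continuous_intros simp: algebra_simps)
    show "touches_above W (\<lambda>x. (x - s0)\<^sup>2 + n * (x - r)\<^sup>2) (\<lambda>y. \<theta> y + (y - t0)\<^sup>2 + n * (y - \<tau>)\<^sup>2) s t"
      unfolding touches_above_def
    proof (rule eventually_nhds_box[OF _ int(1,2)])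
      fix s' t' assume "s' \<in> {s0 - \<rho><..<s0 + \<rho>}" "t' \<in> {t0 - \<rho><..<t0 + \<rho>}"
      then have "\<Phi> ((s', t'), (r, \<tau>)) \<le> \<Phi> ((s, t), (r, \<tau>))"
        using inK by (intro M) (auto simp: K_def)
      then show "W (s', t') - ((fst (s', t') - s0)\<^sup>2 + n * (fst (s', t') - r)\<^sup>2
          + (\<theta> (snd (s', t')) + (snd (s', t') - t0)\<^sup>2 + n * (snd (s', t') - \<tau>)\<^sup>2))
        \<le> W (s, t) - ((s - s0)\<^sup>2 + n * (s - r)\<^sup>2 + (\<theta> t + (t - t0)\<^sup>2 + n * (t - \<tau>)\<^sup>2))"
        by (simp add: \<Phi> distrib_left)
    qed
  qed
  have v1: "2 * n * (t - \<tau>) + h r (2 * n * (s - r)) \<ge> 0"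
  proof (rule super[OF int(3,4), of "\<lambda>x. - n * (s - x)\<^sup>2" "\<lambda>x. 2 * n * (s - x)"
        "\<lambda>y. - n * (t - y)\<^sup>2" "\<lambda>y. 2 * n * (t - y)"])
    show "C1_fun (\<lambda>x. - n * (s - x)\<^sup>2) (\<lambda>x. 2 * n * (s - x))"
      "C1_fun (\<lambda>y. - n * (t - y)\<^sup>2) (\<lambda>y. 2 * n * (t - y))"
      by (auto intro!: C1_funI derivative_eq_intros continuous_intros simp: algebra_simps)
    show "touches_below V (\<lambda>x. - n * (s - x)\<^sup>2) (\<lambda>y. - n * (t - y)\<^sup>2) r \<tau>"
      unfolding touches_below_def
    proof (rule eventually_nhds_box[OF _ int(3,4)])
      fix r' \<tau>' assume "r' \<in> {s0 - \<rho><..<s0 + \<rho>}" "\<tau>' \<in> {t0 - \<rho><..<t0 + \<rho>}"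
      then have "\<Phi> ((s, t), (r', \<tau>')) \<le> \<Phi> ((s, t), (r, \<tau>))"
        using inK by (intro M) (auto simp: K_def)
      then show "V (r, \<tau>) - (- n * (s - r)\<^sup>2 + - n * (t - \<tau>)\<^sup>2)
        \<le> V (r', \<tau>') - (- n * (s - fst (r', \<tau>'))\<^sup>2 + - n * (t - snd (r', \<tau>'))\<^sup>2)"
        by (simp add: \<Phi> distrib_left)
    qed
  qed
  have s01: "s \<in> {0..1}" "r \<in> {0..1}" using int \<rho> by auto
  \<comment> \<open>Otherwise \<open>h\<close> would be at least \<open>B + 1\<close> there, while
    the subsolution inequality and the bound on the time slope give at most
    \<open>B\<close>.\<close>
  have pR: "\<bar>2 * (s - s0) + p\<bar> < R"
    using R[OF s01(1), of "2 * (s - s0) + p"] u1 by (force simp: p_def)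
  have "dist (s, 2 * (s - s0) + p) (r, p) \<le> \<bar>s - r\<bar> + \<bar>2 * (s - s0)\<bar>"
    using sqrt_sum_squares_le_sum_abs[of "s - r" "2 * (s - s0)"]
    by (simp add: dist_Pair_Pair dist_real_def)
  also have "\<dots> < d1" using sr s0t0 d e by auto
  finally have "dist (h s (2 * (s - s0) + p)) (h r p) < \<eta>"
    using uc1[of "(r, p)" "(s, 2 * (s - s0) + p)"] s01 pR s0t0 e by (auto simp: abs_less_iff)
  moreover have "\<bar>\<theta>' t - \<theta>' t0\<bar> < \<eta>" using d2 s0t0 e by auto
  moreover have "\<bar>2 * (t - t0)\<bar> < \<eta>" using s0t0 e by auto
  ultimately show False
    using u1 v1 \<eta> unfolding p_def[symmetric] dist_real_def by linarith
qed

section \<open>Sup-convolution in time\<close>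

text \<open>Uniform continuity on the compact product controls all \<open>f z r\<close> at once in
  \<open>r\<close>; each maximum is then compared with the value at the other point's
  maximizer.\<close>

lemma continuous_on_SUP_compact:
  fixes f :: "'z::metric_space \<Rightarrow> real \<Rightarrow> real"
  assumes "compact Z" and "A \<le> B" and cont: "continuous_on (Z \<times> {A..B}) (\<lambda>(z, r). f z r)"
  shows "continuous_on Z (\<lambda>z. SUP r\<in>{A..B}. f z r)"
    and "z \<in> Z \<Longrightarrow> r \<in> {A..B} \<Longrightarrow> f z r \<le> (SUP r\<in>{A..B}. f z r)"
    and "z \<in> Z \<Longrightarrow> \<exists>r\<in>{A..B}. (SUP r\<in>{A..B}. f z r) = f z r"
proof -
  have sup: "\<exists>r\<in>{A..B}. (SUP r\<in>{A..B}. f z r) = f z r \<and> (\<forall>r'\<in>{A..B}. f z r' \<le> f z r)" if "z \<in> Z" for z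
  proof -
    have "continuous_on {A..B} (\<lambda>r. (\<lambda>(z, r). f z r) (z, r))"
      by (rule continuous_on_compose2[OF cont], intro continuous_intros) (use that in auto)
    then obtain r where r: "r \<in> {A..B}" "\<forall>r'\<in>{A..B}. f z r' \<le> f z r"
      using continuous_attains_sup[of "{A..B}" "f z"] \<open>A \<le> B\<close> by auto
    moreover from r have "(SUP r\<in>{A..B}. f z r) = f z r"
      by (intro cSup_eq_maximum) auto
    ultimately show ?thesis by blast
  qed
  then show ge: "f z r \<le> (SUP r\<in>{A..B}. f z r)" if "z \<in> Z" "r \<in> {A..B}" for z r
    using that by metis
  show att: "\<exists>r\<in>{A..B}. (SUP r\<in>{A..B}. f z r) = f z r" if "z \<in> Z" for z
    using sup that by blast
  have uc: "uniformly_continuous_on (Z \<times> {A..B}) (\<lambda>(z, r). f z r)"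
    by (intro compact_uniformly_continuous compact_Times cont \<open>compact Z\<close>) auto
  show "continuous_on Z (\<lambda>z. SUP r\<in>{A..B}. f z r)"
    unfolding continuous_on_iff
  proof (intro ballI allI impI)
    fix z and e :: real assume z: "z \<in> Z" and "e > 0"
    from uc obtain d where d: "d > 0" and dd: "\<And>y z. \<lbrakk>y \<in> Z \<times> {A..B}; z \<in> Z \<times> {A..B}; dist z y < d\<rbrakk>
        \<Longrightarrow> dist ((\<lambda>(z, r). f z r) z) ((\<lambda>(z, r). f z r) y) < e"
      using \<open>e > 0\<close> unfolding uniformly_continuous_on_def by metis
    have "dist (SUP r\<in>{A..B}. f y r) (SUP r\<in>{A..B}. f z r) < e" if y: "y \<in> Z" "dist y z < d" for y
    proof -
      have close: "\<bar>f y r - f z r\<bar> < e" if "r \<in> {A..B}" for r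
        using dd[of "(z, r)" "(y, r)"] y z that by (auto simp: dist_Pair_Pair dist_real_def)
      obtain r1 r2 where "r1 \<in> {A..B}" "(SUP r\<in>{A..B}. f y r) = f y r1"
          "r2 \<in> {A..B}" "(SUP r\<in>{A..B}. f z r) = f z r2"
        using att y z by metis
      moreover from this have "f y r2 \<le> f y r1" "f z r1 \<le> f z r2"
        using ge y z by metis+
      ultimately show ?thesis
        using close[of r1] close[of r2] by (auto simp: dist_real_def)
    qed
    with d show "\<exists>d>0. \<forall>y\<in>Z. dist y z < d \<longrightarrow>
        dist (SUP r\<in>{A..B}. f y r) (SUP r\<in>{A..B}. f z r) < e" by blast
  qed
qed

text \<open>With \<open>r\<close> frozen, the parabola
  \<open>U (s, r) - k * (\<tau> - r)\<^sup>2\<close> lies below \<open>W (s, \<tau>)\<close> and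
  meets it at \<open>t\<close>, which forces the time slope of \<open>\<beta>\<close>. Shifting the
  test function by \<open>t - r\<close> keeps the penalty constant, so it touches \<open>U\<close>
  at \<open>(s, r)\<close>, where the subsolution property applies.\<close>

lemma sup_convolution_test:
  fixes U W :: "real \<times> real \<Rightarrow> real"
  assumes ge: "\<And>s t r. s \<in> {0..1} \<Longrightarrow> t \<in> {A..B} \<Longrightarrow> r \<in> {A..B} \<Longrightarrow> U (s, r) - k * (t - r)\<^sup>2 \<le> W (s, t)"
    and eq: "W (s, t) = U (s, r) - k * (t - r)\<^sup>2"
    and time: "{A<..<B} \<subseteq> open_time T0 T1"
    and s: "s \<in> {0<..<1}" and t: "t \<in> {A<..<B}" and r: "r \<in> {A<..<B}"
    and visc: "visc_subsol h T0 T1 U"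
    and \<alpha>: "C1_fun \<alpha> \<alpha>'" and \<beta>: "C1_fun \<beta> \<beta>'"
    and touch: "touches_above W \<alpha> \<beta> s t"
  shows "\<beta>' t = - 2 * k * (t - r)" and "\<beta>' t + h s (\<alpha>' s) \<le> 0"
proof -
  have "\<forall>\<^sub>F \<tau> in nhds t. W (s, \<tau>) - (\<alpha> s + \<beta> \<tau>) \<le> W (s, t) - (\<alpha> s + \<beta> t)"
  proof -
    have "((\<lambda>\<tau>. (s, \<tau>)) \<longlongrightarrow> (s, t)) (nhds t)"
      by (intro tendsto_intros) (auto simp: tendsto_def eventually_nhds)
    from filterlim_iff[THEN iffD1, OF this, rule_format, OF touch[unfolded touches_above_def]]
    show ?thesis by simp
  qed
  moreover have "\<forall>\<^sub>F \<tau> in nhds t. \<tau> \<in> {A<..<B}"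
    using t by (intro eventually_nhds_in_open) auto
  ultimately have "\<forall>\<^sub>F \<tau> in nhds t. U (s, r) - k * (\<tau> - r)\<^sup>2 - \<beta> \<tau> \<le> U (s, r) - k * (t - r)\<^sup>2 - \<beta> t"
  proof eventually_elim
    case (elim \<tau>)
    with ge[of s \<tau> r] s r eq show ?case by auto
  qed
  then obtain d where "d > 0" "\<forall>\<tau>. \<bar>t - \<tau>\<bar> < d \<longrightarrow>
      U (s, r) - k * (\<tau> - r)\<^sup>2 - \<beta> \<tau> \<le> U (s, r) - k * (t - r)\<^sup>2 - \<beta> t"
    by (auto simp: eventually_nhds_metric dist_real_def abs_minus_commute)
  moreover have "((\<lambda>\<tau>. U (s, r) - k * (\<tau> - r)\<^sup>2 - \<beta> \<tau>) has_real_derivative - 2 * k * (t - r) - \<beta>' t) (at t)"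
    using \<beta> by (auto simp: C1_fun_def intro!: derivative_eq_intros)
  ultimately show "\<beta>' t = - 2 * k * (t - r)"
    using DERIV_local_max by fastforce
  let ?\<beta> = "\<lambda>\<rho>. \<beta> (\<rho> + (t - r))"
  let ?\<beta>' = "\<lambda>\<rho>. \<beta>' (\<rho> + (t - r))"
  have "C1_fun ?\<beta> ?\<beta>'"
  proof (rule C1_funI)
    show "(?\<beta> has_real_derivative ?\<beta>' x) (at x)" for x
      using \<beta> DERIV_shift[of \<beta> "?\<beta>' x" x "t - r"] by (simp add: C1_fun_def)
    show "continuous_on UNIV ?\<beta>'"
      by (rule continuous_on_compose2[of UNIV \<beta>'])
         (use \<beta> in \<open>auto simp: C1_fun_def intro!: continuous_intros\<close>)
  qed
  moreover have "touches_above U \<alpha> ?\<beta> s r"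
  proof -
    have "((\<lambda>z. (fst z, snd z + (t - r))) \<longlongrightarrow> (fst (s, r), snd (s, r) + (t - r))) (nhds (s, r))"
      by (intro tendsto_intros filterlim_ident)
    then have lim: "((\<lambda>z. (fst z, snd z + (t - r))) \<longlongrightarrow> (s, t)) (nhds (s, r))" by simp
    from filterlim_iff[THEN iffD1, OF lim, rule_format, OF touch[unfolded touches_above_def]]
    have "\<forall>\<^sub>F z in nhds (s, r). W (fst z, snd z + (t - r)) - (\<alpha> (fst z) + ?\<beta> (snd z))
        \<le> W (s, t) - (\<alpha> s + \<beta> t)" by simp
    moreover have "\<forall>\<^sub>F z in nhds (s, r). z \<in> {0<..<1} \<times> {A<..<B}"
      using s r by (intro eventually_nhds_in_open open_Times) auto
    moreover from lim have "\<forall>\<^sub>F z in nhds (s, r). (fst z, snd z + (t - r)) \<in> {0<..<1} \<times> {A<..<B}"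
      by (rule topological_tendstoD) (use s t in \<open>auto intro: open_Times\<close>)
    ultimately show ?thesis
      unfolding touches_above_def
    proof eventually_elim
      case (elim z)
      then have "U (fst z, snd z) - k * (snd z + (t - r) - snd z)\<^sup>2 \<le> W (fst z, snd z + (t - r))"
        by (intro ge) auto
      with elim(1) eq show ?case by simp
    qed
  qed
  moreover have "r \<in> open_time T0 T1" using r time by auto
  ultimately show "\<beta>' t + h s (\<alpha>' s) \<le> 0"
    using visc_subsolD[OF visc _ _ _ \<alpha>, of s r ?\<beta> ?\<beta>'] s by simp
qed

text \<open>Testing \<open>W\<close> inside the arc gives
  \<open>h s (\<alpha>' s) \<le> 2 * k * (t - r)\<close>. Only an upper bound for
  \<open>t - r\<close> matters, hence the least maximizer \<open>r0\<close>. The estimate covers all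
  times near \<open>t0\<close>, as a test function in both variables requires.\<close>

lemma vertex_sup_convolution_bound:
  fixes U W :: "real \<times> real \<Rightarrow> real" and h :: "real \<Rightarrow> real \<Rightarrow> real"
  assumes hcont: "continuous_on ({0..1} \<times> UNIV) (\<lambda>(s, p). h s p)"
    and coercive: "\<forall>K. \<exists>R. \<forall>s\<in>{0..1}. \<forall>p. \<bar>p\<bar> \<ge> R \<longrightarrow> h s p \<ge> K"
    and contU: "continuous_on ({0..1} \<times> {A..B}) U"
    and contW: "continuous_on ({0..1} \<times> {A..B}) W"
    and ge: "\<And>s t r. s \<in> {0..1} \<Longrightarrow> t \<in> {A..B} \<Longrightarrow> r \<in> {A..B} \<Longrightarrow> U (s, r) - k * (t - r)\<^sup>2 \<le> W (s, t)"
    and att: "\<And>s t. s \<in> {0..1} \<Longrightarrow> t \<in> {A..B} \<Longrightarrow> \<exists>r\<in>{A..B}. W (s, t) = U (s, r) - k * (t - r)\<^sup>2"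
    and inner: "\<And>s t r. \<lbrakk>s \<in> {0..1}; \<bar>t - t0\<bar> < \<delta>; r \<in> {A..B}; W (s, t) = U (s, r) - k * (t - r)\<^sup>2\<rbrakk>
        \<Longrightarrow> r \<in> {A<..<B}"
    and \<delta>: "\<delta> > 0" "{t0 - \<delta>..t0 + \<delta>} \<subseteq> {A<..<B}" and "k \<ge> 0"
    and time: "{A<..<B} \<subseteq> open_time T0 T1"
    and visc: "visc_subsol h T0 T1 U"
    and r0: "r0 \<in> {A..B}" "W (1, t0) = U (1, r0) - k * (t0 - r0)\<^sup>2"
    and least: "\<And>r. r \<in> {A..B} \<Longrightarrow> W (1, t0) = U (1, r) - k * (t0 - r)\<^sup>2 \<Longrightarrow> r0 \<le> r"
    and p0: "h 1 p0 < b'" and b': "2 * k * (t0 - r0) < b'"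
  obtains P \<rho> where "\<rho> > 0" "h 1 P < b'"
    "\<And>s t. \<lbrakk>s \<in> {0..1}; 1 - \<rho> < s; \<bar>t - t0\<bar> < \<rho>\<rbrakk> \<Longrightarrow> W (1, t) + P * (s - 1) \<le> W (s, t)"
proof -
  define g where "g = (b' - 2 * k * (t0 - r0)) / 2"
  define b where "b = 2 * k * (t0 - r0) + g"
  have "2 * g = b' - 2 * k * (t0 - r0)" by (simp add: g_def)
  then have g: "g > 0" "b < b'" using b' unfolding b_def by linarith+
  obtain P \<rho>1 where P: "\<rho>1 > 0" "h 1 P < b'"
      "\<And>s p. s \<in> {0..1} \<Longrightarrow> 1 - \<rho>1 < s \<Longrightarrow> h s p \<le> b \<Longrightarrow> p \<le> P"
    by (rule sublevel_bound[OF hcont coercive p0 g(2)]) (rule that, assumption+)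
  \<comment> \<open>\<open>t - r\<close> can exceed \<open>t0 - r0\<close> by at most one
    \<open>e\<close> from \<open>t\<close> and one from \<open>r\<close>; together they raise the
    level by at most \<open>g\<close>. The summand 1 covers \<open>k = 0\<close>.\<close>
  define e where "e = g / (4 * (k + 1))"
  have e: "e > 0" using g \<open>k \<ge> 0\<close> by (simp add: e_def)
  have e2: "2 * k * (e + e) \<le> g"
  proof -
    have "4 * (k + 1) * e = g" using \<open>k \<ge> 0\<close> by (simp add: e_def)
    then show ?thesis using e by (simp add: algebra_simps)
  qed
  have "t0 \<in> {t0 - \<delta>..t0 + \<delta>}" using \<delta>(1) by simp
  with \<delta>(2) have "t0 \<in> {A<..<B}" by blast
  then have t0: "t0 \<in> {A..B}" by simp
  define f where "f = (\<lambda>z r. U (fst z, r) - k * (snd z - r)\<^sup>2)"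
  have contf: "continuous_on (({0..1} \<times> {A..B}) \<times> {A..B}) (\<lambda>(z, r). f z r)"
  proof -
    have "continuous_on (({0..1} \<times> {A..B}) \<times> {A..B}) (\<lambda>x. U (fst (fst x), snd x))"
      by (rule continuous_on_compose2[OF contU])
         (auto intro!: continuous_on_Pair continuous_on_fst continuous_on_snd continuous_on_id)
    then show ?thesis
      unfolding f_def case_prod_unfold by (intro continuous_intros)
  qed
  obtain d where d: "d > 0" and dd: "\<And>z r. \<lbrakk>z \<in> {0..1} \<times> {A..B}; dist z (1, t0) < d; r \<in> {A..B};
      \<And>r'. r' \<in> {A..B} \<Longrightarrow> f z r' \<le> f z r\<rbrakk> \<Longrightarrow> r0 - e < r"
  proof (rule argmax_lower_bound[OF _ contf, of "(1, t0)" r0 e])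
    show "f (1, t0) r \<le> f (1, t0) r0" if "r \<in> {A..B}" for r
      using ge[of 1 t0 r] r0 t0 that by (simp add: f_def)
    show "r0 \<le> r" if "r \<in> {A..B}" "f (1, t0) r = f (1, t0) r0" for r
      using least[of r] r0 that by (simp add: f_def)
  qed (use r0 t0 e in \<open>auto intro: compact_Times\<close>)
  define \<rho> where "\<rho> = Min {\<rho>1, \<delta> / 2, d / 2, e, 1 / 2}"
  have \<rho>: "\<rho> > 0" "\<rho> \<le> \<rho>1" "\<rho> \<le> \<delta> / 2" "\<rho> \<le> d / 2" "\<rho> \<le> e" "\<rho> \<le> 1 / 2"
    using P \<delta> d e by (auto simp: \<rho>_def)
  have inAB: "t \<in> {A<..<B}" if "\<bar>t - t0\<bar> \<le> \<rho>" for t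
  proof -
    have "t \<in> {t0 - \<delta>..t0 + \<delta>}" using that \<rho> \<delta> unfolding atLeastAtMost_iff by linarith
    with \<delta>(2) show ?thesis by blast
  qed
  have cont: "continuous_on ({1 - \<rho>..1} \<times> {t0 - \<rho>..t0 + \<rho>}) W"
  proof (rule continuous_on_subset[OF contW], rule Sigma_mono)
    show "{1 - \<rho>..1} \<subseteq> {0..1}" using \<rho> by auto
    show "{t0 - \<rho>..t0 + \<rho>} \<subseteq> {A..B}"
    proof
      fix t assume "t \<in> {t0 - \<rho>..t0 + \<rho>}"
      then have "t \<in> {A<..<B}" by (intro inAB) auto
      then show "t \<in> {A..B}" by simp
    qed
  qed
  have test: "\<alpha>' s \<le> P" if s: "s \<in> {1 - \<rho><..<1}" and t: "t \<in> {t0 - \<rho><..<t0 + \<rho>}"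
    and C1: "C1_fun \<alpha> \<alpha>'" "C1_fun \<beta> \<beta>'" and touch: "touches_above W \<alpha> \<beta> s t" for \<alpha> \<alpha>' \<beta> \<beta>' s t
  proof -
    have s01: "s \<in> {0<..<1}" "s \<in> {0..1}" using s \<rho> by auto
    have tt: "\<bar>t - t0\<bar> < \<rho>" using t by auto
    then have tAB: "t \<in> {A<..<B}" "t \<in> {A..B}" using inAB[of t] by auto
    obtain r where r: "r \<in> {A..B}" "W (s, t) = U (s, r) - k * (t - r)\<^sup>2"
      using att s01 tAB by blast
    have "r \<in> {A<..<B}"
      using inner[of s t r] s01 tt r \<rho> by auto
    from sup_convolution_test[OF ge r(2) time s01(1) tAB(1) this visc C1 touch]
    have "h s (\<alpha>' s) \<le> 2 * k * (t - r)" by simp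
    also have "\<dots> \<le> 2 * k * ((t0 - r0) + (e + e))"
    proof -
      have "dist (s, t) (1, t0) \<le> \<bar>s - 1\<bar> + \<bar>t - t0\<bar>"
        using sqrt_sum_squares_le_sum_abs[of "s - 1" "t - t0"] by (simp add: dist_Pair_Pair dist_real_def)
      also have "\<dots> < d" using s tt \<rho> by auto
      finally have "r0 - e < r"
        using dd[of "(s, t)" r] s01 tAB r ge[of s t] by (auto simp: f_def)
      then have "t - r \<le> (t0 - r0) + (e + e)" using tt \<rho> by auto
      then show ?thesis using \<open>k \<ge> 0\<close> by (intro mult_left_mono) auto
    qed
    also have "\<dots> \<le> b" using e2 by (simp add: b_def distrib_left)
    finally show ?thesis using P(3)[of s "\<alpha>' s"] s s01 \<rho> by auto
  qed
  show thesis
  proof (rule that[OF \<rho>(1) P(2)])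
    show "W (1, t) + P * (s - 1) \<le> W (s, t)" if "s \<in> {0..1}" "1 - \<rho> < s" "\<bar>t - t0\<bar> < \<rho>" for s t
      by (rule boundary_slope_bound[OF cont]) (rule test, assumption+, use that in auto)
  qed
qed

section \<open>The comparison principle on the network\<close>

text \<open>A real supremum is an upper bound only if the set is bounded above. Coercivity for large
  momenta and compactness for the others bound \<open>h\<close> below, so the infima are genuine and
  lie below the bound for \<open>h s 0\<close>.\<close>

lemma arc_const_le:
  fixes h :: "real \<Rightarrow> real \<Rightarrow> real"
  assumes hcont: "continuous_on ({0..1} \<times> UNIV) (\<lambda>(s, p). h s p)"
    and coercive: "\<forall>K. \<exists>R. \<forall>s\<in>{0..1}. \<forall>p. \<bar>p\<bar> \<ge> R \<longrightarrow> h s p \<ge> K"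
    and "s \<in> {0..1}"
  shows "arc_const h \<le> - (INF p. h s p)"
proof -
  obtain R where R: "\<And>s p. s \<in> {0..1} \<Longrightarrow> \<bar>p\<bar> \<ge> R \<Longrightarrow> h s p \<ge> 0"
    using coercive by metis
  have "compact ((\<lambda>(s, p). h s p) ` ({0..1} \<times> {-\<bar>R\<bar>..\<bar>R\<bar>}))"
    by (intro compact_continuous_image continuous_on_subset[OF hcont] compact_Times) auto
  then obtain C where C: "C > 0" "\<forall>y\<in>(\<lambda>(s, p). h s p) ` ({0..1} \<times> {-\<bar>R\<bar>..\<bar>R\<bar>}). norm y \<le> C"
    by (metis bounded_pos compact_imp_bounded)
  have bound: "\<bar>h s p\<bar> \<le> C" if "s \<in> {0..1}" "p \<in> {-\<bar>R\<bar>..\<bar>R\<bar>}" for s p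
    using C(2) that by (metis (no_types, lifting) SigmaI case_prod_conv imageI real_norm_def)
  have lower: "- C \<le> h s p" if "s \<in> {0..1}" for s p
  proof (cases "\<bar>p\<bar> \<ge> R")
    case True
    with R that C show ?thesis by (meson le_minus_iff less_imp_le neg_le_0_iff_le order_trans)
  next
    case False
    then have "p \<in> {-\<bar>R\<bar>..\<bar>R\<bar>}" unfolding atLeastAtMost_iff by linarith
    from bound[OF that this] show ?thesis by linarith
  qed
  have "bdd_above ((\<lambda>s. INF p. h s p) ` {0..1})"
  proof (rule bdd_aboveI2)
    fix s :: real assume s: "s \<in> {0..1}"
    have "(INF p. h s p) \<le> h s 0"
      by (rule cINF_lower) (auto intro!: bdd_belowI2[of _ "- C"] lower s)
    also have "\<dots> \<le> C" using bound[OF s, of 0] by auto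
    finally show "(INF p. h s p) \<le> C" .
  qed
  then have "(INF p. h s p) \<le> (SUP s\<in>{0..1}. INF p. h s p)"
    using \<open>s \<in> {0..1}\<close> by (rule cSUP_upper2) simp
  then show ?thesis by (simp add: arc_const_def)
qed

lemma HJ_comparison:
  fixes E :: "(real \<Rightarrow> 'a::euclidean_space) set" and u v :: "'a \<times> real \<Rightarrow> real"
  assumes network: "network E" and ham: "hamiltonians E H" and flux: "flux_limiter E H c"
    and sub: "HJ_subsolution E H c T0 T1 u" and super: "HJ_supersolution E H c T0 T1 v"
    and init: "\<And>x. x \<in> net E \<Longrightarrow> u (x, T0) \<le> v (x, T0)"
    and xb: "xb \<in> net E" and tb: "tb \<in> time_dom T0 T1"
  shows "u (xb, tb) \<le> v (xb, tb)"
proof (rule ccontr)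
  assume neg: "\<not> ?thesis"
  with init xb tb have "T0 < tb" by (cases "tb = T0") (auto simp: time_dom_def)
  \<comment> \<open>Stopping before \<open>T1\<close> makes the domain compact; going beyond
    \<open>tb\<close> leaves room to keep the maximum away from the final time.\<close>
  obtain T where T: "tb < T" "ereal T < T1"
    using ereal_dense2[of "ereal tb" T1] tb by (auto simp: time_dom_def)
  have "ereal t < T1" if "t \<le> T" for t
    using T(2) that by (meson ereal_less_eq(3) le_less_trans)
  then have time_closed: "{T0..T} \<subseteq> time_dom T0 T1" and time_open: "{T0<..<T} \<subseteq> open_time T0 T1"
    by (auto simp: time_dom_def open_time_def)
  define N where "N = net E"
  have arcs: "\<And>\<gamma>. \<gamma> \<in> E \<Longrightarrow> simple_path \<gamma>" and "finite E"
    using network by (auto simp: network_def)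
  then have "compact N"
    unfolding N_def net_def by (intro compact_UN compact_path_image simple_path_imp_path) auto
  have in_net: "\<gamma> s \<in> N" if "\<gamma> \<in> E" "s \<in> {0..1}" for \<gamma> s
    using that unfolding N_def net_def path_image_def by blast
  let ?Z = "N \<times> {T0..T}"
  have "compact ?Z" using \<open>compact N\<close> by (intro compact_Times) auto
  have Z_sub: "?Z \<subseteq> net E \<times> time_dom T0 T1"
    unfolding N_def by (rule Sigma_mono[OF subset_refl time_closed])
  have contu: "continuous_on ?Z u"
    by (rule continuous_on_subset[OF _ Z_sub]) (use sub in \<open>simp add: HJ_subsolution_def\<close>)
  have contv: "continuous_on ?Z v"
    by (rule continuous_on_subset[OF _ Z_sub]) (use super in \<open>simp add: HJ_supersolution_def\<close>)
  have cont_along: "continuous_on ({0..1} \<times> {T0..T}) (along f \<gamma>)"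
    if "continuous_on ?Z f" "\<gamma> \<in> E" for f :: "'a \<times> real \<Rightarrow> real" and \<gamma>
  proof -
    have "continuous_on {0..1} \<gamma>"
      using arcs[OF \<open>\<gamma> \<in> E\<close>] by (simp add: simple_path_imp_path flip: path_def)
    then have "continuous_on ({0..1} \<times> {T0..T}) (\<lambda>z. \<gamma> (fst z))"
      by (rule continuous_on_compose2) (auto intro: continuous_on_fst continuous_on_id)
    then have "continuous_on ({0..1} \<times> {T0..T}) (\<lambda>z. (\<gamma> (fst z), snd z))"
      by (intro continuous_on_Pair continuous_on_snd continuous_on_id)
    from continuous_on_compose2[OF that(1) this] in_net[OF \<open>\<gamma> \<in> E\<close>] show ?thesis
      by (auto simp: along_def case_prod_unfold image_subset_iff)
  qed
  have "compact ((\<lambda>z. \<bar>u z\<bar> + \<bar>v z\<bar>) ` ?Z)"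
    by (intro compact_continuous_image continuous_intros contu contv \<open>compact ?Z\<close>)
  then obtain C where C: "C > 0" "\<forall>y\<in>(\<lambda>z. \<bar>u z\<bar> + \<bar>v z\<bar>) ` ?Z. norm y \<le> C"
    by (metis bounded_pos compact_imp_bounded)
  have bound: "\<bar>u z\<bar> \<le> C" "\<bar>v z\<bar> \<le> C" if "z \<in> ?Z" for z
    using C(2) that by force+
  have zb: "(xb, tb) \<in> ?Z" using xb \<open>T0 < tb\<close> T by (simp add: N_def)
  \<comment> \<open>The penalized difference is at least \<open>3 * m\<close> at
    \<open>(xb, tb)\<close>, where \<open>\<theta>\<close> equals \<open>m\<close>. Within
    \<open>\<kappa>\<close> of the initial time it is less: \<open>u\<close> and \<open>v\<close>
    each move by less than \<open>m\<close>, and \<open>w\<close> exceeds \<open>u\<close> by at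
    most \<open>m\<close>.\<close>
  define m where "m = (u (xb, tb) - v (xb, tb)) / 4"
  have "4 * m = u (xb, tb) - v (xb, tb)" by (simp add: m_def)
  with neg have m: "m > 0" "u (xb, tb) = v (xb, tb) + 4 * m" by linarith+
  have "uniformly_continuous_on ?Z u" "uniformly_continuous_on ?Z v"
    by (intro compact_uniformly_continuous contu contv \<open>compact ?Z\<close>)+
  then obtain \<kappa>1 \<kappa>2 where \<kappa>1: "\<kappa>1 > 0" and uc1: "\<And>y z. \<lbrakk>y \<in> ?Z; z \<in> ?Z; dist z y < \<kappa>1\<rbrakk> \<Longrightarrow> dist (u z) (u y) < m"
      and \<kappa>2: "\<kappa>2 > 0" and uc2: "\<And>y z. \<lbrakk>y \<in> ?Z; z \<in> ?Z; dist z y < \<kappa>2\<rbrakk> \<Longrightarrow> dist (v z) (v y) < m"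
    using m(1) unfolding uniformly_continuous_on_def by metis
  define T' where "T' = (tb + T) / 2"
  have T': "tb < T'" "T' < T" using T by (auto simp: T'_def)
  define \<kappa> where "\<kappa> = Min {\<kappa>1, \<kappa>2, T - T'}"
  have \<kappa>: "\<kappa> > 0" "\<kappa> \<le> \<kappa>1" "\<kappa> \<le> \<kappa>2" "\<kappa> \<le> T - T'" using \<kappa>1 \<kappa>2 T' by (auto simp: \<kappa>_def)
  have ut: "\<bar>u (x, t) - u (x, t')\<bar> < m" "\<bar>v (x, t) - v (x, t')\<bar> < m"
    if "x \<in> N" "t \<in> {T0..T}" "t' \<in> {T0..T}" "\<bar>t - t'\<bar> < \<kappa>" for x t t'
    using uc1[of "(x, t')" "(x, t)"] uc2[of "(x, t')" "(x, t)"] that \<kappa>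
    by (auto simp: dist_Pair_Pair dist_real_def)

  \<comment> \<open>\<open>K\<close> makes \<open>\<theta>\<close> grow from \<open>m\<close> at
    \<open>tb\<close> to more than \<open>m + 2 * C\<close> from \<open>T'\<close> on, so that the
    difference is negative there.\<close>
  define K where "K = (2 * C + 1) / (m * (T' - tb))"
  define \<theta> where "\<theta> = (\<lambda>t. m * exp (K * (t - tb)))"
  define \<theta>' where "\<theta>' = (\<lambda>t. m * K * exp (K * (t - tb)))"
  have K: "K > 0" using C m T' by (simp add: K_def)
  have \<theta>: "C1_fun \<theta> \<theta>'"
    unfolding \<theta>_def \<theta>'_def by (auto intro!: C1_funI derivative_eq_intros continuous_intros)
  have \<theta>_pos: "\<theta> t > 0" "\<theta>' t > 0" for t using m K by (auto simp: \<theta>_def \<theta>'_def)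
  have \<theta>_large: "\<theta> t \<ge> m + 2 * C + 1" if "t \<ge> T'" for t
  proof -
    have "m + 2 * C + 1 = m * (1 + K * (T' - tb))"
      using m T' by (simp add: K_def field_simps)
    also have "\<dots> \<le> m * exp (K * (T' - tb))"
      using m by (intro mult_left_mono exp_ge_add_one_self) auto
    also have "\<dots> \<le> \<theta> t"
      using m K that by (simp add: \<theta>_def)
    finally show ?thesis .
  qed

  \<comment> \<open>A time shift of \<open>\<kappa> / 2\<close> costs more than the oscillation
    \<open>2 * C\<close> of \<open>u\<close>, so every maximizer \<open>r\<close> lies within
    \<open>\<kappa> / 2\<close> of \<open>t\<close>. For \<open>t\<close> within
    \<open>\<kappa> / 2\<close> of \<open>t0\<close> it is then interior to the time
    interval.\<close>
  define k where "k = (2 * C + 1) / (\<kappa> / 2)\<^sup>2"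
  have k: "k > 0" "k * (\<kappa> / 2)\<^sup>2 = 2 * C + 1" using C \<kappa> by (auto simp: k_def)
  define f where "f = (\<lambda>z r. u (fst z, r) - k * (snd z - r)\<^sup>2)"
  define w where "w z = (SUP r\<in>{T0..T}. f z r)" for z
  have contf: "continuous_on (?Z \<times> {T0..T}) (\<lambda>(z, r). f z r)"
  proof -
    have "continuous_on (?Z \<times> {T0..T}) (\<lambda>x. u (fst (fst x), snd x))"
      by (rule continuous_on_compose2[OF contu])
         (auto intro!: continuous_on_Pair continuous_on_fst continuous_on_snd continuous_on_id)
    then show ?thesis
      unfolding f_def case_prod_unfold by (intro continuous_intros)
  qed
  have "T0 \<le> T" using \<open>T0 < tb\<close> T by simp
  note sup = continuous_on_SUP_compact[OF \<open>compact ?Z\<close> \<open>T0 \<le> T\<close> contf, folded w_def]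
  have w_ge: "u (x, r) - k * (t - r)\<^sup>2 \<le> w (x, t)" if "x \<in> N" "t \<in> {T0..T}" "r \<in> {T0..T}" for x t r
    using sup(2)[of "(x, t)" r] that by (simp add: f_def)
  have w_att: "\<exists>r\<in>{T0..T}. w (x, t) = u (x, r) - k * (t - r)\<^sup>2" if "x \<in> N" "t \<in> {T0..T}" for x t
    using sup(3)[of "(x, t)"] that by (simp add: f_def)
  have near: "\<bar>t - r\<bar> < \<kappa> / 2"
    if "x \<in> N" "t \<in> {T0..T}" "r \<in> {T0..T}" "w (x, t) = u (x, r) - k * (t - r)\<^sup>2" for x t r
  proof -
    have "k * (t - r)\<^sup>2 \<le> u (x, r) - u (x, t)"
      using w_ge[of x t t] that by simp
    also have "\<dots> \<le> 2 * C" using bound(1)[of "(x, r)"] bound(1)[of "(x, t)"] that by (simp add: abs_le_iff)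
    finally have "k * (t - r)\<^sup>2 < k * (\<kappa> / 2)\<^sup>2" using k by linarith
    then have "\<bar>t - r\<bar>\<^sup>2 < (\<kappa> / 2)\<^sup>2" using k(1) by (simp only: mult_less_cancel_left_pos power2_abs)
    then show ?thesis by (rule power2_less_imp_less) (use \<kappa> in simp)
  qed
  have w_le: "w (x, t) \<le> u (x, t) + m" if "x \<in> N" "t \<in> {T0..T}" for x t
  proof -
    obtain r where r: "r \<in> {T0..T}" "w (x, t) = u (x, r) - k * (t - r)\<^sup>2"
      using w_att \<open>x \<in> N\<close> \<open>t \<in> {T0..T}\<close> by blast
    have "\<bar>u (x, t) - u (x, r)\<bar> < m" using near[OF that r] that r \<kappa> by (intro ut) auto
    moreover have "0 \<le> k * (t - r)\<^sup>2" using k by simp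
    ultimately show ?thesis using r by linarith
  qed

  have cont\<theta>: "continuous_on ?Z (\<lambda>z. \<theta> (snd z))"
    by (rule continuous_on_compose2[OF C1_fun_continuous_on[OF \<theta>, of UNIV]])
       (auto intro: continuous_on_snd continuous_on_id)
  have "continuous_on ?Z (\<lambda>z. w z - v z - \<theta> (snd z))"
    by (intro continuous_intros sup(1) contv cont\<theta>)
  then obtain z0 where z0: "z0 \<in> ?Z" "\<And>z. z \<in> ?Z \<Longrightarrow> w z - v z - \<theta> (snd z) \<le> w z0 - v z0 - \<theta> (snd z0)"
    using continuous_attains_sup[OF \<open>compact ?Z\<close>] zb by (metis (no_types, lifting) empty_iff)
  obtain x0 t0 where z0_eq: "z0 = (x0, t0)" by (cases z0)
  have x0: "x0 \<in> N" and t0: "t0 \<in> {T0..T}" using z0 by (auto simp: z0_eq)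
  define M where "M = w (x0, t0) - v (x0, t0) - \<theta> t0"
  have max: "w (x, t) - v (x, t) - \<theta> t \<le> M" if "x \<in> N" "t \<in> {T0..T}" for x t
    using z0(2)[of "(x, t)"] that by (simp add: z0_eq M_def)
  have M: "M \<ge> 3 * m"
    using max[of xb tb] w_ge[of xb tb tb] m zb by (simp add: \<theta>_def)
  have "t0 \<ge> T0 + \<kappa>"
  proof (rule ccontr)
    assume "\<not> ?thesis"
    then have "\<bar>u (x0, t0) - u (x0, T0)\<bar> < m" "\<bar>v (x0, t0) - v (x0, T0)\<bar> < m"
      using t0 \<open>T0 \<le> T\<close> by (auto intro!: ut x0)
    with init[of x0] w_le[OF x0 t0] M \<theta>_pos(1)[of t0] x0 show False
      unfolding M_def N_def by linarith
  qed
  moreover have "t0 \<le> T - \<kappa>"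
  proof (rule ccontr)
    assume "\<not> ?thesis"
    then have "\<theta> t0 \<ge> m + 2 * C + 1" using \<kappa> by (intro \<theta>_large) auto
    with w_le[OF x0 t0] M m bound[of "(x0, t0)"] x0 t0 show False
      unfolding M_def by auto
  qed
  ultimately have inner: "t \<in> {T0<..<T}" if "\<bar>t - t0\<bar> < \<kappa>" for t
    using that by auto
  have inner': "t \<in> {T0..T}" if "\<bar>t - t0\<bar> < \<kappa>" for t
    using inner[OF that] by auto
  have t0': "t0 \<in> {T0<..<T}" using inner[of t0] \<kappa> by simp
  have argmax_inner: "r \<in> {T0<..<T}"
    if "x \<in> N" "\<bar>t - t0\<bar> < \<kappa> / 2" "r \<in> {T0..T}" "w (x, t) = u (x, r) - k * (t - r)\<^sup>2" for x t r
  proof (rule inner)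
    have "t \<in> {T0..T}" using that(2) \<kappa> by (intro inner') linarith
    from near[OF that(1) this that(3,4)] that(2) show "\<bar>r - t0\<bar> < \<kappa>" by linarith
  qed

  have hcont: "continuous_on ({0..1} \<times> UNIV) (\<lambda>(s, p). H \<gamma> s p)"
    and coercive: "\<forall>K. \<exists>R. \<forall>s\<in>{0..1}. \<forall>p. \<bar>p\<bar> \<ge> R \<longrightarrow> H \<gamma> s p \<ge> K" if "\<gamma> \<in> E" for \<gamma>
    using ham that by (auto simp: hamiltonians_def)
  have visc_u: "visc_subsol (H \<gamma>) T0 T1 (along u \<gamma>)" and visc_v: "visc_supersol (H \<gamma>) T0 T1 (along v \<gamma>)"
    if "\<gamma> \<in> E" for \<gamma>
    using sub super that by (auto simp: HJ_subsolution_def HJ_supersolution_def)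
  have along_ge: "along u \<gamma> (s, r) - k * (t - r)\<^sup>2 \<le> along w \<gamma> (s, t)"
    if "\<gamma> \<in> E" "s \<in> {0..1}" "t \<in> {T0..T}" "r \<in> {T0..T}" for \<gamma> s t r
    using w_ge[OF in_net[OF that(1,2)] that(3,4)] by (simp add: along_def)

  show False
  proof (cases "x0 \<in> vertices E")
    case False
    obtain \<gamma> s0 where \<gamma>: "\<gamma> \<in> E" and s0: "s0 \<in> {0..1}" "x0 = \<gamma> s0"
      using x0 by (auto simp: N_def net_def path_image_def)
    have "s0 \<noteq> 0" "s0 \<noteq> 1"
      using False \<gamma> s0 by (auto simp: vertices_def pathstart_def pathfinish_def)
    then have s0': "0 < s0" "s0 < 1" using s0 by auto
    define \<rho> where "\<rho> = Min {s0 / 2, (1 - s0) / 2, \<kappa> / 2}"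
    have "\<rho> > 0" using s0' \<kappa> by (simp add: \<rho>_def)
    moreover have "\<rho> \<le> s0 / 2" "\<rho> \<le> (1 - s0) / 2" "\<rho> \<le> \<kappa> / 2"
      unfolding \<rho>_def by (rule Min_le, simp, simp)+
    ultimately have \<rho>: "\<rho> > 0" "0 < s0 - \<rho>" "s0 + \<rho> < 1" "\<rho> \<le> \<kappa> / 2"
      using s0' by (simp_all add: field_simps)
    have t_in: "t \<in> {T0<..<T}" if "t \<in> {t0 - \<rho>..t0 + \<rho>}" for t
      using that \<rho> \<kappa> by (intro inner) auto
    have s_in: "s \<in> {0<..<1}" if "s \<in> {s0 - \<rho>..s0 + \<rho>}" for s
      using that \<rho> by auto
    have box: "{s0 - \<rho>..s0 + \<rho>} \<times> {t0 - \<rho>..t0 + \<rho>} \<subseteq> {0..1} \<times> {T0..T}"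
    proof (rule Sigma_mono)
      show "{s0 - \<rho>..s0 + \<rho>} \<subseteq> {0..1}" using \<rho>(2,3) by simp
      show "{t0 - \<rho>..t0 + \<rho>} \<subseteq> {T0..T}"
      proof
        fix t assume "t \<in> {t0 - \<rho>..t0 + \<rho>}"
        from t_in[OF this] show "t \<in> {T0..T}" by simp
      qed
    qed
    show False
    proof (rule no_interior_maximum[OF hcont[OF \<gamma>] coercive[OF \<gamma>] \<rho>(1-3) \<theta> \<theta>_pos(2)])
      show "continuous_on ({s0 - \<rho>..s0 + \<rho>} \<times> {t0 - \<rho>..t0 + \<rho>}) (along w \<gamma>)"
        by (rule continuous_on_subset[OF cont_along[OF sup(1) \<gamma>] box])
      show "continuous_on ({s0 - \<rho>..s0 + \<rho>} \<times> {t0 - \<rho>..t0 + \<rho>}) (along v \<gamma>)"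
        by (rule continuous_on_subset[OF cont_along[OF contv \<gamma>] box])
      show "along w \<gamma> (s, t) - along v \<gamma> (s, t) - \<theta> t \<le> along w \<gamma> (s0, t0) - along v \<gamma> (s0, t0) - \<theta> t0"
        if "s \<in> {s0 - \<rho>..s0 + \<rho>}" "t \<in> {t0 - \<rho>..t0 + \<rho>}" for s t
        using max[of "\<gamma> s" t] in_net[OF \<gamma>, of s] s_in[OF that(1)] t_in[OF that(2)]
        by (simp add: along_def M_def s0(2))
    next
      fix \<alpha> \<alpha>' \<beta> \<beta>' s t
      assume st: "s \<in> {s0 - \<rho><..<s0 + \<rho>}" "t \<in> {t0 - \<rho><..<t0 + \<rho>}"
        and C1: "C1_fun \<alpha> \<alpha>'" "C1_fun \<beta> \<beta>'"
      have s: "s \<in> {0<..<1}" and t: "t \<in> {T0<..<T}" using s_in[of s] t_in[of t] st by auto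
      then have st': "s \<in> {0..1}" "t \<in> {T0..T}" by auto
      {
        assume touch: "touches_above (along w \<gamma>) \<alpha> \<beta> s t"
        obtain r where r: "r \<in> {T0..T}" "w (\<gamma> s, t) = u (\<gamma> s, r) - k * (t - r)\<^sup>2"
          using w_att in_net[OF \<gamma> st'(1)] st'(2) by blast
        have "\<bar>t - t0\<bar> < \<kappa> / 2"
          using st(2) \<rho>(4) unfolding greaterThanLessThan_iff by linarith
        from argmax_inner[OF in_net[OF \<gamma> st'(1)] this r] have rr: "r \<in> {T0<..<T}" .
        have eq: "along w \<gamma> (s, t) = along u \<gamma> (s, r) - k * (t - r)\<^sup>2"
          using r by (simp add: along_def)
        have test: "\<beta>' t = - 2 * k * (t - r)" "\<beta>' t + H \<gamma> s (\<alpha>' s) \<le> 0"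
          by (rule sup_convolution_test[OF _ eq time_open s t rr visc_u[OF \<gamma>] C1 touch];
              rule along_ge[OF \<gamma>]; assumption)+
        have "\<bar>\<beta>' t\<bar> = 2 * k * \<bar>t - r\<bar>"
          unfolding test(1) abs_mult using k by simp
        also have "\<dots> \<le> 2 * k * (T - T0)"
          using k t rr by (intro mult_left_mono) auto
        finally show "\<beta>' t + H \<gamma> s (\<alpha>' s) \<le> 0 \<and> \<bar>\<beta>' t\<bar> \<le> 2 * k * (T - T0)"
          using test(2) by simp
      next
        assume "touches_below (along v \<gamma>) \<alpha> \<beta> s t"
        then show "\<beta>' t + H \<gamma> s (\<alpha>' s) \<ge> 0"
          using visc_supersolD[OF visc_v[OF \<gamma>] _ _ _ C1] s t time_open by auto
      }
    qed
  next
    case True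
    have "continuous_on {T0..T} (\<lambda>r. (\<lambda>(z, r). f z r) ((x0, t0), r))"
      by (rule continuous_on_compose2[OF contf], intro continuous_intros) (use x0 t0 in auto)
    then have "continuous_on {T0..T} (f (x0, t0))" by simp
    \<comment> \<open>The maximizers form a nonempty compact set, so a least one exists.\<close>
    moreover define S where "S = {r \<in> {T0..T}. f (x0, t0) r = w (x0, t0)}"
    ultimately have "closed S"
      unfolding S_def by (intro continuous_closed_preimage_constant) auto
    then have "compact ({T0..T} \<inter> S)" by (intro compact_Int_closed) auto
    moreover have "{T0..T} \<inter> S = S" by (auto simp: S_def)
    moreover have "S \<noteq> {}"
      using sup(3)[of "(x0, t0)"] x0 t0 by (force simp: S_def)
    ultimately obtain r0 where "r0 \<in> S" "\<And>r. r \<in> S \<Longrightarrow> r0 \<le> r"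
      using compact_attains_inf[of S] by auto
    then have r0: "r0 \<in> {T0..T}" "w (x0, t0) = u (x0, r0) - k * (t0 - r0)\<^sup>2"
      and least: "\<And>r. \<lbrakk>r \<in> {T0..T}; w (x0, t0) = u (x0, r) - k * (t0 - r)\<^sup>2\<rbrakk> \<Longrightarrow> r0 \<le> r"
      by (auto simp: S_def f_def)
    have r0': "r0 \<in> {T0<..<T}" using argmax_inner[OF x0 _ r0] \<kappa> by auto

    \<comment> \<open>Maximality of \<open>r0\<close> in the sup-convolution says that
      \<open>u (x0, r) - \<psi> r\<close> is largest at \<open>r0\<close>, so the vertex condition
      for subsolutions applies.\<close>
    define \<psi> where "\<psi> = (\<lambda>r. k * (t0 - r)\<^sup>2)"
    have \<psi>: "C1_fun \<psi> (\<lambda>r. - 2 * k * (t0 - r))"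
      unfolding \<psi>_def
      by (auto intro!: C1_funI derivative_eq_intros continuous_intros simp: algebra_simps)
    have "supertangent UNIV (\<lambda>\<tau>. u (x0, \<tau>)) r0 \<psi>"
      unfolding supertangent_def
    proof (intro conjI C1_near_C1_fun[OF \<psi>])
      have "open {T0<..<T}" by simp
      then obtain \<epsilon> where \<epsilon>: "\<epsilon> > 0" "ball r0 \<epsilon> \<subseteq> {T0<..<T}" using r0' by (meson openE)
      have "u (x0, r) - \<psi> r \<le> u (x0, r0) - \<psi> r0" if "r \<in> ball r0 \<epsilon>" for r
      proof -
        have "r \<in> {T0<..<T}" using \<epsilon> that by blast
        then have "r \<in> {T0..T}" by auto
        from w_ge[OF x0 t0 this] r0 show ?thesis by (simp add: \<psi>_def)
      qed
      with \<epsilon> show "\<exists>\<epsilon>>0. \<forall>r\<in>ball r0 \<epsilon> \<inter> UNIV. u (x0, r) - \<psi> r \<le> u (x0, r0) - \<psi> r0" by blast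
    qed
    moreover have "deriv \<psi> r0 = - 2 * k * (t0 - r0)"
      using \<psi> by (simp add: C1_fun_def DERIV_imp_deriv)
    ultimately have slope: "- 2 * k * (t0 - r0) \<le> c x0"
      using sub True r0' time_open by (fastforce simp: HJ_subsolution_def)

    \<comment> \<open>With \<open>r0\<close> frozen, \<open>w (x0, t)\<close> is at least
      \<open>u (x0, r0) - k * (t - r0)\<^sup>2\<close>, with equality at \<open>t0\<close>.
      Maximality of \<open>M\<close> turns this into a lower bound for \<open>v (x0, t)\<close> by
      \<open>\<phi> t\<close> plus a constant.\<close>
    define \<phi> where "\<phi> = (\<lambda>t. - k * (t - r0)\<^sup>2 - \<theta> t)"
    define \<phi>' where "\<phi>' = (\<lambda>t. - 2 * k * (t - r0) - \<theta>' t)"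
    have \<phi>: "C1_fun \<phi> \<phi>'"
      using \<theta> unfolding \<phi>_def \<phi>'_def C1_fun_def
      by (auto intro!: derivative_eq_intros continuous_intros simp: algebra_simps)
    have "subtangent UNIV (\<lambda>\<tau>. v (x0, \<tau>)) t0 \<phi>"
      unfolding subtangent_def
    proof (intro conjI C1_near_C1_fun[OF \<phi>])
      have "v (x0, t0) - \<phi> t0 \<le> v (x0, t) - \<phi> t" if "t \<in> ball t0 \<kappa>" for t
      proof -
        have "\<bar>t - t0\<bar> < \<kappa>" using that by (simp add: dist_real_def abs_minus_commute)
        from max[OF x0 inner'[OF this]] w_ge[OF x0 inner'[OF this] r0(1)] r0(2) show ?thesis
          by (simp add: \<phi>_def M_def)
      qed
      with \<kappa> show "\<exists>\<epsilon>>0. \<forall>t\<in>ball t0 \<epsilon> \<inter> UNIV. v (x0, t0) - \<phi> t0 \<le> v (x0, t) - \<phi> t" by blast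
    qed
    moreover have "deriv \<phi> t0 < c x0"
    proof -
      have "deriv \<phi> t0 = \<phi>' t0" using \<phi> by (simp add: C1_fun_def DERIV_imp_deriv)
      then show ?thesis using slope \<theta>_pos(2)[of t0] by (simp add: \<phi>'_def)
    qed
    ultimately obtain \<gamma> where \<gamma>x: "\<gamma> \<in> arcs_into E x0" and
      state: "\<And>\<phi>. subtangent ({0..1} \<times> closure (open_time T0 T1)) (along v \<gamma>) (1, t0) \<phi>
        \<Longrightarrow> HJ_expr (H \<gamma>) \<phi> 1 t0 \<ge> 0"
      using super True t0' time_open unfolding HJ_supersolution_def by (meson subsetD)
    have \<gamma>: "\<gamma> \<in> E" "\<gamma> 1 = x0" using \<gamma>x by (auto simp: arcs_into_def pathfinish_def)

    \<comment> \<open>This is \<open>- \<phi>' t0\<close>, so a momentum with Hamiltonian below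
      \<open>b'\<close> violates the supersolution inequality. One exists: the infimum of
      \<open>H \<gamma> 1\<close> is at most \<open>- c x0\<close>, hence at most
      \<open>2 * k * (t0 - r0)\<close>.\<close>
    define b' where "b' = 2 * k * (t0 - r0) + \<theta>' t0"
    have "c x0 \<le> arc_const (H \<gamma>)"
    proof -
      have "c x0 \<le> Min ((\<lambda>\<gamma>. arc_const (H \<gamma>)) ` arcs_into E x0)"
        using flux True by (auto simp: flux_limiter_def)
      also have "\<dots> \<le> arc_const (H \<gamma>)"
        using \<open>finite E\<close> \<gamma>x by (intro Min_le) (auto simp: arcs_into_def)
      finally show ?thesis .
    qed
    also have "\<dots> \<le> - (INF p. H \<gamma> 1 p)"
      by (rule arc_const_le[OF hcont[OF \<gamma>(1)] coercive[OF \<gamma>(1)]]) simp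
    finally have "(INF p. H \<gamma> 1 p) < b'"
      using slope \<theta>_pos(2)[of t0] by (simp add: b'_def)
    then obtain p0 where p0: "H \<gamma> 1 p0 < b'"
      using cInf_lessD[of "range (H \<gamma> 1)" b'] by auto

    obtain P \<rho> where \<rho>: "\<rho> > 0" and P: "H \<gamma> 1 P < b'"
      and lower: "\<And>s t. \<lbrakk>s \<in> {0..1}; 1 - \<rho> < s; \<bar>t - t0\<bar> < \<rho>\<rbrakk>
        \<Longrightarrow> along w \<gamma> (1, t) + P * (s - 1) \<le> along w \<gamma> (s, t)"
    proof (rule vertex_sup_convolution_bound[OF hcont[OF \<gamma>(1)] coercive[OF \<gamma>(1)]
          cont_along[OF contu \<gamma>(1)] cont_along[OF sup(1) \<gamma>(1)] along_ge[OF \<gamma>(1)] _ _ _ _ _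
          time_open visc_u[OF \<gamma>(1)] r0(1) _ _ p0])
      show "\<exists>r\<in>{T0..T}. along w \<gamma> (s, t) = along u \<gamma> (s, r) - k * (t - r)\<^sup>2"
        if "s \<in> {0..1}" "t \<in> {T0..T}" for s t
        using w_att[OF in_net[OF \<gamma>(1) that(1)] that(2)] by (simp add: along_def)
      show "r \<in> {T0<..<T}" if "s \<in> {0..1}" "\<bar>t - t0\<bar> < \<kappa> / 2" "r \<in> {T0..T}"
        "along w \<gamma> (s, t) = along u \<gamma> (s, r) - k * (t - r)\<^sup>2" for s t r
        using argmax_inner[OF in_net[OF \<gamma>(1) that(1)] that(2,3)] that(4) by (simp add: along_def)
      show "{t0 - \<kappa> / 2..t0 + \<kappa> / 2} \<subseteq> {T0<..<T}"
      proof
        fix t assume "t \<in> {t0 - \<kappa> / 2..t0 + \<kappa> / 2}"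
        then show "t \<in> {T0<..<T}" using \<kappa> by (intro inner) auto
      qed
      show "2 * k * (t0 - r0) < b'" using \<theta>_pos(2)[of t0] by (simp add: b'_def)
      show "r0 \<le> r" if "r \<in> {T0..T}" "along w \<gamma> (1, t0) = along u \<gamma> (1, r) - k * (t0 - r)\<^sup>2" for r
        using least[of r] that by (simp add: along_def \<gamma>(2))
    qed (use \<kappa> k r0(2) in \<open>auto simp: along_def \<gamma>(2)\<close>)

    have PC1: "C1_fun (\<lambda>s. P * s) (\<lambda>s. P)"
      by (auto intro!: C1_funI derivative_eq_intros)
    have "subtangent ({0..1} \<times> closure (open_time T0 T1)) (along v \<gamma>) (1, t0) (\<lambda>z. P * fst z + \<phi> (snd z))"
      unfolding subtangent_def
    proof (intro conjI C1_near_separated[OF PC1 \<phi>])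
      define \<epsilon> where "\<epsilon> = min \<rho> \<kappa>"
      have \<epsilon>: "\<epsilon> > 0" "\<epsilon> \<le> \<rho>" "\<epsilon> \<le> \<kappa>" using \<rho> \<kappa> by (auto simp: \<epsilon>_def)
      have "along v \<gamma> (1, t0) - (P * fst (1, t0) + \<phi> (snd (1, t0))) \<le> along v \<gamma> z - (P * fst z + \<phi> (snd z))"
        if z: "z \<in> ball (1, t0) \<epsilon> \<inter> {0..1} \<times> closure (open_time T0 T1)" for z
      proof -
        obtain s t where st: "z = (s, t)" by (cases z)
        have s: "s \<in> {0..1}" using z by (simp add: st)
        have "dist 1 s < \<epsilon>" "dist t0 t < \<epsilon>"
          using z dist_fst_le[of "(1, t0)" z] dist_snd_le[of "(1, t0)" z] by (auto simp: st)
        then have *: "1 - \<rho> < s" "\<bar>t - t0\<bar> < \<rho>" "\<bar>t - t0\<bar> < \<kappa>"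
          using \<epsilon> by (auto simp: dist_real_def)
        note t = inner'[OF *(3)]
        have "w (x0, t) + P * (s - 1) \<le> w (\<gamma> s, t)"
          using lower[OF s *(1,2)] by (simp add: along_def \<gamma>(2))
        with max[OF in_net[OF \<gamma>(1) s] t] w_ge[OF x0 t r0(1)] r0(2) show ?thesis
          by (simp add: st along_def \<gamma>(2) \<phi>_def M_def algebra_simps)
      qed
      with \<epsilon>(1) show "\<exists>\<epsilon>>0. \<forall>z\<in>ball (1, t0) \<epsilon> \<inter> {0..1} \<times> closure (open_time T0 T1).
          along v \<gamma> (1, t0) - (P * fst (1, t0) + \<phi> (snd (1, t0))) \<le> along v \<gamma> z - (P * fst z + \<phi> (snd z))"
        by blast
    qed
    from state[OF this] have "\<phi>' t0 + H \<gamma> 1 P \<ge> 0"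
      by (simp add: HJ_expr_separated[OF PC1 \<phi>])
    with P show False by (simp add: \<phi>'_def b'_def)
  qed
qed

text \<open>Each solution is both a subsolution and a supersolution with the same initial values, so
  comparison applies in both orders.\<close>

theorem corollary7p2:
  fixes E :: "(real \<Rightarrow> 'a::euclidean_space) set"
    and H :: "(real \<Rightarrow> 'a) \<Rightarrow> real \<Rightarrow> real \<Rightarrow> real"
    and c :: "'a \<Rightarrow> real"
    and T0 :: real and T1 :: ereal
    and g :: "'a \<Rightarrow> real"
    and u v :: "'a \<times> real \<Rightarrow> real"
  assumes "network E"
    and "hamiltonians E H"
    and "flux_limiter E H c"
    and "0 \<le> T0" and "ereal T0 < T1"
    and "continuous_on (net E) g"
    and "HJ_solution E H c T0 T1 u"
    and "uniformly_continuous_on (net E \<times> time_dom T0 T1) u"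
    and "\<forall>x\<in>net E. u (x, T0) = g x"
    and "HJ_solution E H c T0 T1 v"
    and "uniformly_continuous_on (net E \<times> time_dom T0 T1) v"
    and "\<forall>x\<in>net E. v (x, T0) = g x"
  shows "\<forall>z \<in> net E \<times> time_dom T0 T1. u z = v z"
proof
  fix z assume "z \<in> net E \<times> time_dom T0 T1"
  then obtain x t where z: "z = (x, t)" "x \<in> net E" "t \<in> time_dom T0 T1" by auto
  have sub: "HJ_subsolution E H c T0 T1 u" "HJ_subsolution E H c T0 T1 v"
    and super: "HJ_supersolution E H c T0 T1 u" "HJ_supersolution E H c T0 T1 v"
    using assms(7,10) by (auto simp: HJ_solution_def)
  have init: "u (x, T0) \<le> v (x, T0)" "v (x, T0) \<le> u (x, T0)" if "x \<in> net E" for x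
    using that assms(9,12) by simp_all
  show "u z = v z"
    using HJ_comparison[OF assms(1-3) sub(1) super(2) init(1) z(2,3)]
      HJ_comparison[OF assms(1-3) sub(2) super(1) init(2) z(2,3)]
    by (simp add: z(1))
qed

end
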